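(* Fix $p>0$. For any $\Lambda\in(-\infty,\Lambda_{*,p})\cup[\Lambda_{\mathrm{sph}},\infty)$ the problem $$\Delta^2u=(1-|x|^p)e^{4u}\quad\text{in }\mathbb{R}^4,\qquad \Lambda=\int_{\mathbb{R}^4}(1-|x|^p)e^{4u}\,dx,$$ admits no normal solutions. In particular, for $p\ge4$ this problem admits no normal solutions (for any $\Lambda$).
   Context: Constants: $\Lambda_{\mathrm{sph}}:=16\pi^2$ and, for $p>0$, $\Lambda_{*,p}:=(4+p)2\pi^2=\left(1+\frac p4\right)\frac{\Lambda_{\mathrm{sph}}}{2}$. Normal solution: given $K\in L^\infty_{loc}(\mathbb{R}^4)$, a function $u$ is a normal solution of $\Delta^2u=Ke^{4u}$ in $\mathbb{R}^4$ if $Ke^{4u}\in L^1(\mathbb{R}^4)$ and $u$ solves the integral equation $$u(x)=\frac{1}{8\pi^2}\int_{\mathbb{R}^4}\log\left(\frac{|y|}{|x-y|}\right)K(y)e^{4u(y)}\,dy+c$$ for some constant $c\in\mathbb{R}$. Here $K(x)=1-|x|^p$. *)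

theory Defs
  imports "HOL-Analysis.Analysis"
begin

definition Lambda_sph :: real where
  "Lambda_sph = 16 * pi\<^sup>2"

definition Lambda_star :: "real \<Rightarrow> real" where
  "Lambda_star p = (4 + p) * 2 * pi\<^sup>2"

lemma Lambda_star_eq: "Lambda_star p = (1 + p / 4) * (Lambda_sph / 2)"
  by (simp add: Lambda_star_def Lambda_sph_def field_simps)

text \<open>
  Normal solutions of the equation \<open>\<Delta>\<^sup>2 u = K e\<^sup>4\<^sup>u\<close> in four-dimensional Euclidean space.
  As \<open>K\<close> is only determined up to null sets, the integral equation is understood almost everywhere.
  Since the Bochner integral of a non-integrable function is \<open>0\<close> by convention, the
  convergence of the integral on the right-hand side is part of the definition.  The values of the
  logarithm at \<open>y = 0\<close> and \<open>y = x\<close> are immaterial.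
\<close>

definition normal_solution :: "(real^4 \<Rightarrow> real) \<Rightarrow> (real^4 \<Rightarrow> real) \<Rightarrow> bool" where
  "normal_solution K u \<longleftrightarrow>
     integrable lebesgue (\<lambda>y. K y * exp (4 * u y)) \<and>
     (\<exists>c. AE x in lebesgue.
        integrable lebesgue (\<lambda>y. ln (norm y / norm (x - y)) * K y * exp (4 * u y)) \<and>
        u x = 1 / (8 * pi\<^sup>2) *
          (\<integral>y. ln (norm y / norm (x - y)) * K y * exp (4 * u y) \<partial>lebesgue) + c)"

definition K_pow :: "real \<Rightarrow> real^4 \<Rightarrow> real" where
  "K_pow p x = 1 - norm x powr p"

end

theory Submission
  imports Defs
begin

text \<open>
  Let \<open>f = (1 - \<bar>x\<bar>\<^sup>p) e\<^sup>4\<^sup>u\<close> be the density of a normal solution and \<open>\<Lambda>\<close> its integral.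

  Since \<open>f \<le> 0\<close> off the unit ball, only the part of \<open>f\<close> in the unit ball can make \<open>u\<close> large. The
  Brezis--Merle argument shows that this part is square integrable, so that its logarithmic potential is bounded
  and \<open>u\<close> is locally bounded above.

  The upper bound \<open>\<Lambda> < 16 \<pi>\<^sup>2\<close> is the Pohozaev identity
  \<open>4 \<Lambda> - \<Lambda>\<^sup>2 / (4 \<pi>\<^sup>2) = p \<integral> \<bar>x\<bar>\<^sup>p e\<^sup>4\<^sup>u > 0\<close>. To avoid differentiating \<open>u\<close>, the kernel
  \<open>log \<bar>x - y\<bar>\<close> is replaced by \<open>log \<surd>(\<bar>x - y\<bar>\<^sup>2 + \<epsilon>\<^sup>2)\<close> and the
  dilation derivative of the integral of \<open>\<phi> K e\<^sup>4\<^sup>u\<close>, with a cutoff \<open>\<phi>\<close>, is computed for the regularised \<open>u\<close>. As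
  \<open>\<epsilon> \<rightarrow> 0\<close>, symmetrisation leaves a bounded kernel, because \<open>x \<phi>(x)\<close> is Lipschitz uniformly in the
  radius \<open>R\<close> of the cutoff, and \<open>R \<rightarrow> \<infinity>\<close> is dominated convergence without any decay of \<open>u\<close>.

  For the lower bound \<open>\<Lambda> \<ge> (4 + p) 2 \<pi>\<^sup>2\<close>, the average of \<open>u\<close> over a ball of radius \<open>R\<close> at distance \<open>2 R\<close> from the
  origin is at least \<open>- (\<Lambda> / 8 \<pi>\<^sup>2) log R - o(log R)\<close>. By Jensen's inequality the
  integral of \<open>\<bar>x\<bar>\<^sup>p e\<^sup>4\<^sup>u\<close> over this ball is at least \<open>R\<close> to the power
  \<open>4 + p - \<Lambda> / (2 \<pi>\<^sup>2) - o(1)\<close>, and it stays bounded.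
\<close>

section \<open>The singular kernel and the logarithmic kernel\<close>

lemma nn_integral_lborel_affine:
  fixes t :: "'a::euclidean_space"
  assumes [measurable]: "f \<in> borel_measurable borel" and c: "c \<noteq> 0"
  shows "(\<integral>\<^sup>+x. f x \<partial>lborel) = ennreal (\<bar>c\<bar> ^ DIM('a)) * (\<integral>\<^sup>+x. f (t + c *\<^sub>R x) \<partial>lborel)"
  by (subst lborel_affine[OF c, of t])
     (simp add: nn_integral_density nn_integral_distr nn_integral_cmult)

lemma integrable_lborel_scale:
  fixes f :: "'a::euclidean_space \<Rightarrow> real"
  assumes f: "integrable lborel f" and c: "c \<noteq> 0"
  shows "integrable lborel (\<lambda>x. f (c *\<^sub>R x))"
proof -
  have [measurable]: "f \<in> borel_measurable borel"
    using f by auto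
  show ?thesis
    using f c unfolding integrable_iff_bounded
    by (subst (asm) nn_integral_lborel_affine[where c=c and t=0]) (auto simp: ennreal_mult_less_top)
qed

lemma integral_lborel_scale:
  fixes f :: "'a::euclidean_space \<Rightarrow> real"
  assumes f: "integrable lborel f" and c: "c \<noteq> 0"
  shows "integral\<^sup>L lborel f = \<bar>c\<bar> ^ DIM('a) * (\<integral>x. f (c *\<^sub>R x) \<partial>lborel)"
proof -
  have [measurable]: "f \<in> borel_measurable borel"
    using f by auto
  show ?thesis
    using c integrable_lborel_scale[OF f c]
    by (subst lborel_affine[OF c, of 0]) (simp add: integral_density integral_distr)
qed

section \<open>Local integrability of 1/|z| and its uniform consequences\<close>

text \<open>Dyadic decomposition: on the shell 2^-(k+1) <= |z| < 2^-k the integrand is at most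
  2^(k+1), while the ball of radius 2^-k has volume proportional to 2^(-kd). For d >= 2 the
  resulting series is dominated by a geometric one.\<close>

lemma nn_integral_inverse_norm_ball_finite:
  assumes "DIM('a::euclidean_space) \<ge> 2"
  shows "(\<integral>\<^sup>+z. indicator (ball (0::'a) 1) z * ennreal (1 / norm z) \<partial>lborel) < \<infinity>"
proof -
  have [measurable]: "ball (0::'a) r \<in> sets borel" for r by simp
  have term_le: "h k \<le> suminf h" for h :: "nat \<Rightarrow> ennreal" and k
    using sum_le_suminf[of h "{k}"] by simp
  define V where "V = unit_ball_vol (real DIM('a))"
  have V0: "V \<ge> 0" unfolding V_def by simp
  have bound: "indicator (ball (0::'a) 1) z * ennreal (1 / norm z)
      \<le> (\<Sum>k. ennreal (2 ^ Suc k) * indicator (ball 0 ((1/2) ^ k)) z)" for z :: 'a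
  proof (cases "z \<in> ball 0 1 \<and> z \<noteq> 0")
    case False
    then have "indicator (ball (0::'a) 1) z * ennreal (1 / norm z) = 0"
      by (auto simp: indicator_def)
    then show ?thesis by (simp only: zero_le)
  next
    case True
    then have z: "0 < norm z" "norm z < 1" by auto
    obtain k0 where "(1/2) ^ k0 < norm z"
      using z real_arch_pow_inv[of "norm z" "1/2"] by auto
    \<comment> \<open>The dyadic shell containing \<open>z\<close>; minimality of \<open>k\<close>
      gives the strict upper bound on \<open>norm z\<close>.\<close>
    define k where "k = (LEAST k. (1/2) ^ Suc k \<le> norm z)"
    have ex: "(1/2) ^ Suc k0 \<le> norm z"
      unfolding power_Suc using z \<open>(1/2) ^ k0 < norm z\<close> by linarith
    have k1: "(1/2) ^ Suc k \<le> norm z"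
      unfolding k_def by (rule LeastI[of _ k0]) (rule ex)
    have k2: "norm z < (1/2) ^ k"
    proof (cases k)
      case 0
      then show ?thesis using z by simp
    next
      case (Suc j)
      then have "\<not> (1/2) ^ Suc j \<le> norm z"
        using not_less_Least[of j "\<lambda>k. (1/2) ^ Suc k \<le> norm z"] unfolding k_def by auto
      then show ?thesis using Suc by simp
    qed
    have "1 / norm z \<le> 2 ^ Suc k"
      using k1 z by (simp add: field_simps power_one_over)
    then have "indicator (ball 0 1) z * ennreal (1 / norm z)
        \<le> ennreal (2 ^ Suc k) * indicator (ball 0 ((1/2) ^ k)) z"
      using k2 True by (simp add: ennreal_leI del: power_Suc)
    also have "\<dots> \<le> (\<Sum>k. ennreal (2 ^ Suc k) * indicator (ball 0 ((1/2) ^ k)) z)"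
      by (rule term_le)
    finally show ?thesis .
  qed
  have "(\<integral>\<^sup>+z. indicator (ball (0::'a) 1) z * ennreal (1 / norm z) \<partial>lborel)
      \<le> (\<integral>\<^sup>+z. (\<Sum>k. ennreal (2 ^ Suc k) * indicator (ball (0::'a) ((1/2) ^ k)) z) \<partial>lborel)"
    by (intro nn_integral_mono bound)
  also have "\<dots> = (\<Sum>k. \<integral>\<^sup>+z. ennreal (2 ^ Suc k) * indicator (ball (0::'a) ((1/2) ^ k)) z \<partial>lborel)"
    by (intro nn_integral_suminf) measurable
  also have "\<dots> = (\<Sum>k. ennreal (2 ^ Suc k * (V * ((1/2) ^ k) ^ DIM('a))))"
    using V0 by (intro suminf_cong)
      (simp add: nn_integral_cmult_indicator emeasure_ball V_def ennreal_mult' del: power_Suc)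
  also have "\<dots> \<le> (\<Sum>k. ennreal (2 * V * (1/2) ^ k))"
  proof (intro suminf_le allI ennreal_leI)
    fix k :: nat
    have "((1/2) ^ k) ^ DIM('a) \<le> ((1/2::real) ^ k) ^ 2"
      using assms by (intro power_decreasing) (auto simp: power_le_one)
    then have "2 ^ Suc k * (V * ((1/2) ^ k) ^ DIM('a)) \<le> 2 ^ Suc k * (V * ((1/2::real) ^ k) ^ 2)"
      using V0 by (intro mult_left_mono) auto
    also have "\<dots> = 2 * V * (1/2) ^ k"
      by (simp add: power2_eq_square power_one_over field_simps)
    finally show "2 ^ Suc k * (V * ((1/2) ^ k) ^ DIM('a)) \<le> 2 * V * (1/2) ^ k" .
  qed auto
  also have "\<dots> < \<infinity>"
    using V0 by (subst suminf_ennreal2) (auto intro!: summable_mult summable_geometric)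
  finally show ?thesis .
qed

text \<open>Finite by the preceding lemma. The potential estimates below are expressed through this
  constant, without computing its value.\<close>

definition ball_pot :: real where
  "ball_pot = enn2real (\<integral>\<^sup>+z. indicator (ball (0::real^4) 1) z * ennreal (1 / norm z) \<partial>lborel)"

lemma ball_pot_nonneg: "ball_pot \<ge> 0"
  by (simp add: ball_pot_def)

lemma nn_integral_inverse_norm_ball:
  "(\<integral>\<^sup>+x. indicator (ball y 1) x * ennreal (1 / norm (x - y)) \<partial>lborel) = ennreal ball_pot"
  for y :: "real^4"
proof -
  have [measurable]: "ball y 1 \<in> sets borel" by simp
  have "(\<integral>\<^sup>+x. indicator (ball y 1) x * ennreal (1 / norm (x - y)) \<partial>lborel)
      = (\<integral>\<^sup>+x. indicator (ball y 1) (y + 1 *\<^sub>R x) * ennreal (1 / norm (y + 1 *\<^sub>R x - y)) \<partial>lborel)"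
    by (subst nn_integral_lborel_affine[where c=1 and t=y]) simp_all
  also have "\<dots> = (\<integral>\<^sup>+x. indicator (ball (0::real^4) 1) x * ennreal (1 / norm x) \<partial>lborel)"
    by (intro nn_integral_cong) (auto simp: indicator_def dist_norm)
  also have "\<dots> = ennreal ball_pot"
    unfolding ball_pot_def
    using nn_integral_inverse_norm_ball_finite[where 'a="real^4"] by (simp add: less_top)
  finally show ?thesis .
qed

text \<open>Within distance 1 of \<open>y\<close> the kernel contributes at most
  \<open>ball_pot\<close>, and beyond that distance it is at most 1. The bound is uniform in
  \<open>y\<close>, which is what the Fubini arguments need.\<close>

lemma nn_integral_inverse_norm_le:
  fixes y :: "real^4"
  assumes [measurable]: "S \<in> sets borel" and fin: "emeasure lborel S < \<infinity>"
  shows "(\<integral>\<^sup>+x. indicator S x * ennreal (1 / norm (x - y)) \<partial>lborel) \<le> ennreal (measure lborel S + ball_pot)"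
proof -
  have [measurable]: "ball y 1 \<in> sets borel" by simp
  have "(\<integral>\<^sup>+x. indicator S x * ennreal (1 / norm (x - y)) \<partial>lborel)
     \<le> (\<integral>\<^sup>+x. indicator S x + indicator (ball y 1) x * ennreal (1 / norm (x - y)) \<partial>lborel)"
  proof (intro nn_integral_mono)
    fix x
    show "indicator S x * ennreal (1 / norm (x - y))
        \<le> indicator S x + indicator (ball y 1) x * ennreal (1 / norm (x - y))"
      by (cases "x \<in> ball y 1"; cases "x \<in> S")
        (auto simp: dist_norm norm_minus_commute divide_le_eq_1 intro!: ennreal_leI)
  qed
  also have "\<dots> = emeasure lborel S + ennreal ball_pot"
    by (subst nn_integral_add) (simp_all add: nn_integral_inverse_norm_ball)
  also have "\<dots> = ennreal (measure lborel S + ball_pot)"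
    using fin by (simp add: emeasure_eq_ennreal_measure ball_pot_nonneg less_top)
  finally show ?thesis .
qed

text \<open>Jensen's inequality for a weight of total mass at most 1: the missing mass is treated as
  an extra atom at which \<open>A\<close> vanishes. For mass exactly 1 this is the usual
  inequality.\<close>

lemma exp_weighted_le:
  fixes g A :: "'a \<Rightarrow> real"
  assumes g: "integrable M g" and gA: "integrable M (\<lambda>y. g y * A y)"
    and gE: "integrable M (\<lambda>y. g y * exp (A y))"
    and nn: "\<And>y. g y \<ge> 0" and le1: "integral\<^sup>L M g \<le> 1"
  shows "exp (\<integral>y. g y * A y \<partial>M) \<le> 1 - integral\<^sup>L M g + (\<integral>y. g y * exp (A y) \<partial>M)"
proof -
  define m where "m = (\<integral>y. g y * A y \<partial>M)"
  define \<theta> where "\<theta> = integral\<^sup>L M g"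
  have "exp m * (g y * (1 - m) + g y * A y) \<le> g y * exp (A y)" for y
  proof -
    \<comment> \<open>The tangent line of the exponential at \<open>m\<close>, rescaled by
      \<open>exp m\<close> in the next line.\<close>
    have "1 + (A y - m) \<le> exp (A y - m)" by (rule exp_ge_add_one_self)
    then have "exp m * (1 + (A y - m)) \<le> exp (A y)"
      by (metis exp_diff exp_gt_zero mult.commute pos_le_divide_eq)
    then have "g y * (exp m * (1 + (A y - m))) \<le> g y * exp (A y)"
      by (rule mult_left_mono[OF _ nn])
    then show ?thesis by (simp add: algebra_simps)
  qed
  then have "(\<integral>y. exp m * (g y * (1 - m) + g y * A y) \<partial>M) \<le> (\<integral>y. g y * exp (A y) \<partial>M)"
    using g gA gE by (intro integral_mono) auto
  then have 1: "exp m * (\<theta> * (1 - m) + m) \<le> (\<integral>y. g y * exp (A y) \<partial>M)"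
    using g gA by (simp add: m_def \<theta>_def)
  \<comment> \<open>The same tangent line evaluated at 0; it accounts for the missing mass.\<close>
  have "exp m * (1 - m) \<le> 1"
  proof -
    have "1 - m \<le> exp (- m)" using exp_ge_add_one_self[of "-m"] by simp
    then have "exp m * (1 - m) \<le> exp m * exp (- m)" by (intro mult_left_mono) auto
    then show ?thesis by (simp add: exp_minus)
  qed
  then have "(1 - \<theta>) * (exp m * (1 - m)) \<le> (1 - \<theta>) * 1"
    using le1 by (intro mult_left_mono) (auto simp: \<theta>_def)
  then show ?thesis
    using 1 unfolding m_def[symmetric] \<theta>_def[symmetric] by (simp add: algebra_simps)
qed

lemma AE_lborel_neq: "AE y in lborel. y \<noteq> (x::'a::euclidean_space)"
  by (rule AE_I[of _ _ "{x}"]) auto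

text \<open>By Tonelli the \<open>x\<close>-integral is taken first; it is bounded uniformly in
  \<open>y\<close>, and the integrability of \<open>g\<close> does the rest.\<close>

lemma integrable_pair_inverse_norm:
  fixes g :: "real^4 \<Rightarrow> real"
  assumes g: "integrable lborel g" and S[measurable]: "S \<in> sets borel"
    and fin: "emeasure lborel S < \<infinity>"
  shows "integrable (lborel \<Otimes>\<^sub>M lborel) (\<lambda>(x, y). indicator S x * (g y / norm (x - y)))"
proof -
  have [measurable]: "g \<in> borel_measurable borel"
    using g by auto
  have "(\<integral>\<^sup>+xy. ennreal (norm (case xy of (x, y) \<Rightarrow> indicator S x * (g y / norm (x - y))))
         \<partial>(lborel \<Otimes>\<^sub>M lborel))
      = (\<integral>\<^sup>+y. (\<integral>\<^sup>+x. ennreal (norm (indicator S x * (g y / norm (x - y)))) \<partial>lborel) \<partial>lborel)"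
    by (subst lborel_pair.nn_integral_snd[symmetric]) simp_all
  also have "\<dots> \<le> (\<integral>\<^sup>+y. ennreal (norm (g y)) * ennreal (measure lborel S + ball_pot) \<partial>lborel)"
  proof (intro nn_integral_mono)
    fix y
    have "(\<integral>\<^sup>+x. ennreal (norm (indicator S x * (g y / norm (x - y)))) \<partial>lborel)
        = (\<integral>\<^sup>+x. ennreal (norm (g y)) * (indicator S x * ennreal (1 / norm (x - y))) \<partial>lborel)"
      by (intro nn_integral_cong)
        (auto simp: indicator_def ennreal_mult'[symmetric])
    also have "\<dots> = ennreal (norm (g y)) * (\<integral>\<^sup>+x. indicator S x * ennreal (1 / norm (x - y)) \<partial>lborel)"
      by (rule nn_integral_cmult) simp
    also have "\<dots> \<le> ennreal (norm (g y)) * ennreal (measure lborel S + ball_pot)"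
      by (intro mult_left_mono nn_integral_inverse_norm_le S fin) simp
    finally show "(\<integral>\<^sup>+x. ennreal (norm (indicator S x * (g y / norm (x - y)))) \<partial>lborel)
        \<le> ennreal (norm (g y)) * ennreal (measure lborel S + ball_pot)" .
  qed
  also have "\<dots> = (\<integral>\<^sup>+y. ennreal (norm (g y)) \<partial>lborel) * ennreal (measure lborel S + ball_pot)"
    by (rule nn_integral_multc) simp
  also have "\<dots> < \<infinity>"
    using g unfolding integrable_iff_bounded by (simp add: ennreal_mult_less_top)
  finally show ?thesis
    by (intro integrableI_bounded) simp_all
qed

lemma integrable_inverse_norm_ball:
  "integrable lborel (\<lambda>y. indicator (ball (x::real^4) 1) y * (1 / norm (x - y)))"
  and integral_inverse_norm_ball:
  "(\<integral>y. indicator (ball (x::real^4) 1) y * (1 / norm (x - y)) \<partial>lborel) = ball_pot"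
proof -
  have [measurable]: "ball x 1 \<in> sets borel" by simp
  have eq: "ennreal (indicator (ball x 1) y * (1 / norm (x - y)))
      = indicator (ball x 1) y * ennreal (1 / norm (y - x))" for y
    by (auto simp: indicator_def norm_minus_commute)
  have "has_bochner_integral lborel (\<lambda>y. indicator (ball x 1) y * (1 / norm (x - y))) ball_pot"
    by (rule has_bochner_integral_nn_integral)
      (simp_all add: ball_pot_nonneg nn_integral_inverse_norm_ball eq del: times_divide_eq_right mult_1_right)
  then show "integrable lborel (\<lambda>y. indicator (ball x 1) y * (1 / norm (x - y)))"
    "(\<integral>y. indicator (ball x 1) y * (1 / norm (x - y)) \<partial>lborel) = ball_pot"
    by (auto simp: has_bochner_integral_iff simp del: times_divide_eq_right mult_1_right)
qed

text \<open>Differs from \<open>log (\<bar>y\<bar> / \<bar>x - y\<bar>)\<close> by a function of \<open>y\<close> alone, which only changes the additive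
  constant of a normal solution; unlike the original kernel it is not singular at \<open>y = 0\<close>.\<close>

definition logk :: "real^4 \<Rightarrow> real^4 \<Rightarrow> real" where
  "logk x y = ln (1 + norm y) - ln (norm (x - y))"

lemma logk_measurable[measurable]: "case_prod logk \<in> borel_measurable (borel \<Otimes>\<^sub>M borel)"
  unfolding logk_def by measurable

lemma one_plus_norm_mult_le: "1 + norm x + norm y \<le> (1 + norm x) * (1 + norm y)"
  by (simp add: algebra_simps)

text \<open>Rests on |x - y| <= (1 + |x|)(1 + |y|). On the diagonal the convention
  \<open>ln 0 = 0\<close> makes \<open>logk\<close> nonnegative.\<close>

lemma logk_ge: "- ln (1 + norm x) \<le> logk x y"
proof (cases "x = y")
  case False
  have "norm (x - y) \<le> 1 + norm x + norm y"
    using norm_triangle_ineq4[of x y] by linarith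
  also have "\<dots> \<le> (1 + norm x) * (1 + norm y)"
    by (rule one_plus_norm_mult_le)
  finally have "ln (norm (x - y)) \<le> ln ((1 + norm x) * (1 + norm y))"
    using False by (intro ln_mono) (auto intro!: mult_pos_pos add_pos_nonneg)
  also have "\<dots> = ln (1 + norm x) + ln (1 + norm y)"
    by (rule ln_mult_pos) (auto simp: add_pos_nonneg)
  finally show ?thesis by (simp add: logk_def)
qed (simp add: logk_def)

text \<open>Combines log t <= t - 1 with 1 + |y| <= 1 + |x| + |x - y|; the term |x - y| / |x - y|
  cancels the -1.\<close>

lemma logk_le: 
  assumes "x \<noteq> y"
  shows "logk x y \<le> (1 + norm x) / norm (x - y)"
proof -
  have pos: "norm (x - y) > 0" using assms by simp
  have "logk x y = ln ((1 + norm y) / norm (x - y))"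
    unfolding logk_def using pos by (subst ln_divide_pos) (auto simp: add_pos_nonneg)
  also have "\<dots> \<le> (1 + norm y) / norm (x - y) - 1"
    using pos by (intro ln_le_minus_one divide_pos_pos) (auto simp: add_pos_nonneg)
  also have "(1 + norm y) / norm (x - y) \<le> (1 + norm x + norm (x - y)) / norm (x - y)"
    using norm_triangle_ineq2[of y x] by (intro divide_right_mono) (auto simp: norm_minus_commute)
  also have "\<dots> - 1 = (1 + norm x) / norm (x - y)"
    using pos by (simp add: add_divide_distrib)
  finally show ?thesis by simp
qed

lemma abs_logk_le: "\<bar>logk x y\<bar> \<le> ln (1 + norm x) + (1 + norm x) / norm (x - y)"
proof (cases "x = y")
  case False
  then show ?thesis using logk_ge[of x y] logk_le[OF False]
    by (simp add: abs_le_iff) (smt (verit) divide_nonneg_nonneg norm_ge_zero ln_ge_zero)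
qed (simp add: logk_def)

section \<open>The positive part of log(1/r) and its integrals\<close>

text \<open>This is log^+(1/r) for r > 0, with \<open>lp 0 = 0\<close> by the convention
  \<open>ln 0 = 0\<close>. It carries the only singularity of \<open>logk\<close>.\<close>

definition lp :: "real \<Rightarrow> real" where
  "lp r = max 0 (- ln r)"

lemma lp_measurable[measurable]: "lp \<in> borel_measurable borel"
  unfolding lp_def by measurable

lemma lp_nonneg: "0 \<le> lp r"
  by (simp add: lp_def)

lemma lp_le:
  assumes "r \<ge> 0"
  shows "lp r \<le> indicator {..<1} r * (1 / r)"
proof (cases "r = 0 \<or> r \<ge> 1")
  case True
  then show ?thesis by (auto simp: lp_def indicator_def)
next
  case False
  then have r: "0 < r" "r < 1" using assms by auto
  have "- ln r = ln (1 / r)" using r by (simp add: ln_div)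
  also have "\<dots> \<le> 1 / r - 1" using r by (intro ln_le_minus_one) auto
  finally show ?thesis using r by (simp add: lp_def)
qed

text \<open>Applying log t <= t - 1 at t = r^(-1/2) rather than 1/r makes the square comparable to
  1/r, hence integrable with a bound uniform in the centre.\<close>

lemma lp_square_le:
  assumes "r \<ge> 0"
  shows "(lp r)\<^sup>2 \<le> indicator {..<1} r * (4 / r)"
proof (cases "r = 0 \<or> r \<ge> 1")
  case True
  then show ?thesis by (auto simp: lp_def indicator_def)
next
  case False
  then have r: "0 < r" "r < 1" using assms by auto
  have "lp r = 2 * ln (1 / sqrt r)" using r by (simp add: lp_def ln_div ln_sqrt)
  also have "\<dots> \<le> 2 * (1 / sqrt r)" 
    using ln_le_minus_one[of "1 / sqrt r"] r by simp
  finally have "(lp r)\<^sup>2 \<le> (2 * (1 / sqrt r))\<^sup>2"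
    using lp_nonneg by (intro power_mono) auto
  also have "\<dots> = 4 / r" using r by (simp add: power_divide)
  finally show ?thesis using r by simp
qed

lemma exp_lp_le:
  assumes "r \<ge> 0"
  shows "exp (lp r) \<le> 1 + 1 / r"
proof (cases "r = 0")
  case False
  then have "exp (- ln r) = 1 / r" using assms by (simp add: exp_minus field_simps)
  then show ?thesis using assms by (auto simp: lp_def max_def)
qed (simp add: lp_def)

lemma integrable_lp: "integrable lborel (\<lambda>y. lp (norm (x - y)))"
  and integral_lp_le: "(\<integral>y. lp (norm (x - y)) \<partial>lborel) \<le> ball_pot"
  for x :: "real^4"
proof -
  have le: "lp (norm (x - y)) \<le> indicator (ball x 1) y * (1 / norm (x - y))" for y
    using lp_le[of "norm (x - y)"] by (auto simp: indicator_def dist_norm split: if_splits)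
  show 1: "integrable lborel (\<lambda>y. lp (norm (x - y)))"
    by (rule Bochner_Integration.integrable_bound[OF integrable_inverse_norm_ball[of x]])
      (use le lp_nonneg in \<open>auto intro!: AE_I2 simp: abs_of_nonneg\<close>)
  show "(\<integral>y. lp (norm (x - y)) \<partial>lborel) \<le> ball_pot"
    using integral_mono[OF 1 integrable_inverse_norm_ball[of x] le] integral_inverse_norm_ball[of x] by simp
qed

lemma integrable_lp_square: "integrable lborel (\<lambda>y. (lp (norm (x - y)))\<^sup>2)"
  and integral_lp_square_le: "(\<integral>y. (lp (norm (x - y)))\<^sup>2 \<partial>lborel) \<le> 4 * ball_pot"
  for x :: "real^4"
proof -
  have le: "(lp (norm (x - y)))\<^sup>2 \<le> 4 * (indicator (ball x 1) y * (1 / norm (x - y)))" for y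
    using lp_square_le[of "norm (x - y)"] by (auto simp: indicator_def dist_norm split: if_splits)
  have i: "integrable lborel (\<lambda>y. 4 * (indicator (ball x 1) y * (1 / norm (x - y))))"
    by (intro integrable_mult_right integrable_inverse_norm_ball)
  show 1: "integrable lborel (\<lambda>y. (lp (norm (x - y)))\<^sup>2)"
    by (rule Bochner_Integration.integrable_bound[OF i])
      (use le in \<open>auto intro!: AE_I2 order.trans[OF le abs_ge_self] simp del: times_divide_eq_right mult_1_right\<close>)
  show "(\<integral>y. (lp (norm (x - y)))\<^sup>2 \<partial>lborel) \<le> 4 * ball_pot"
    using integral_mono[OF 1 i le] integral_inverse_norm_ball[of x] 
    by (simp del: times_divide_eq_right mult_1_right)
qed

lemma ball_borel[measurable]: "ball (a::real^4) r \<in> sets borel"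
  by simp

section \<open>Local upper bounds\<close>

text \<open>\<open>U\<close> is a Borel representative for which the integral equation is imposed at
  every point, whereas convergence of the integral is assumed only almost everywhere. Convergence at
  every point is derived in \<open>logk_dens_integrable\<close>.\<close>

locale normal_potential =
  fixes p c :: real and U :: "real^4 \<Rightarrow> real"
  assumes p_pos: "p > 0"
    and U_measurable[measurable]: "U \<in> borel_measurable borel"
    and density_integrable: "integrable lborel (\<lambda>y. K_pow p y * exp (4 * U y))"
    and logk_density_integrable_AE:
      "AE x in lborel. integrable lborel (\<lambda>y. logk x y * (K_pow p y * exp (4 * U y)))"
    and U_eq: "\<And>x. U x = 1 / (8 * pi\<^sup>2) * (\<integral>y. logk x y * (K_pow p y * exp (4 * U y)) \<partial>lborel) + c"
begin

definition dens :: "real^4 \<Rightarrow> real" where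
  "dens y = K_pow p y * exp (4 * U y)"

text \<open>As 1 - |x|^p changes sign across the unit sphere, this is the positive part of
  \<open>dens\<close>.\<close>

definition pos_dens :: "real^4 \<Rightarrow> real" where
  "pos_dens y = indicator (ball 0 1) y * dens y"

definition logpot :: "real^4 \<Rightarrow> real" where
  "logpot x = (\<integral>y. lp (norm (x - y)) * pos_dens y \<partial>lborel)"

definition abs_mass :: real where
  "abs_mass = (\<integral>y. \<bar>dens y\<bar> \<partial>lborel)"

lemma K_pow_measurable[measurable]: "K_pow p \<in> borel_measurable borel"
  unfolding K_pow_def by measurable

lemma dens_measurable[measurable]: "dens \<in> borel_measurable borel"
  unfolding dens_def by measurable

lemma pos_dens_measurable[measurable]: "pos_dens \<in> borel_measurable borel"
  unfolding pos_dens_def by measurable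

lemma dens_integrable: "integrable lborel dens"
  using density_integrable unfolding dens_def .

lemma pos_dens_integrable: "integrable lborel pos_dens"
  by (rule Bochner_Integration.integrable_bound[OF dens_integrable]) (auto simp: pos_dens_def indicator_def)

lemma logpot_measurable[measurable]: "logpot \<in> borel_measurable borel"
  unfolding logpot_def by measurable

lemma K_pow_nonneg: "norm y \<le> 1 \<Longrightarrow> 0 \<le> K_pow p y"
  using p_pos powr_le1[of p "norm y"] by (simp add: K_pow_def)

lemma K_pow_nonpos: "norm y \<ge> 1 \<Longrightarrow> K_pow p y \<le> 0"
  using p_pos ge_one_powr_ge_zero[of "norm y" p] by (simp add: K_pow_def)

lemma K_pow_le: "K_pow p y \<le> 1"
  by (simp add: K_pow_def)

lemma abs_K_pow_le: "norm y \<le> R \<Longrightarrow> \<bar>K_pow p y\<bar> \<le> 1 + R powr p"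
  using p_pos powr_mono2[of p "norm y" R] by (simp add: K_pow_def abs_le_iff) (smt (verit) powr_ge_zero)

lemma dens_nonneg: "norm y \<le> 1 \<Longrightarrow> 0 \<le> dens y"
  using K_pow_nonneg by (simp add: dens_def)

lemma dens_nonpos: "norm y \<ge> 1 \<Longrightarrow> dens y \<le> 0"
  using K_pow_nonpos by (simp add: dens_def mult_nonpos_nonneg)

lemma pos_dens_nonneg: "0 \<le> pos_dens y"
  using dens_nonneg by (auto simp: pos_dens_def indicator_def)

lemma abs_mass_nonneg: "0 \<le> abs_mass"
  by (simp add: abs_mass_def)

lemma logk_dens_integrable_AE: "AE x in lborel. integrable lborel (\<lambda>y. logk x y * dens y)"
  using logk_density_integrable_AE unfolding dens_def .

lemma U_eq_dens: "U x = 1 / (8 * pi\<^sup>2) * (\<integral>y. logk x y * dens y \<partial>lborel) + c"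
  using U_eq unfolding dens_def .

lemma logpot_integrable_AE: "AE x in lborel. integrable lborel (\<lambda>y. lp (norm (x - y)) * pos_dens y)"
  using logk_dens_integrable_AE
proof eventually_elim
  case (elim x)
  show ?case
  proof (rule Bochner_Integration.integrable_bound[OF elim])
    show "AE y in lborel. norm (lp (norm (x - y)) * pos_dens y) \<le> norm (logk x y * dens y)"
    proof (rule AE_I2)
      fix y
      have "lp (norm (x - y)) \<le> \<bar>logk x y\<bar>"
        using ln_ge_zero[of "1 + norm y"] norm_ge_zero[of y] unfolding lp_def logk_def by linarith
      then have "\<bar>lp (norm (x - y))\<bar> * \<bar>pos_dens y\<bar> \<le> \<bar>logk x y\<bar> * \<bar>dens y\<bar>"
        using lp_nonneg by (intro mult_mono) (auto simp: pos_dens_def indicator_def)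
      then show "norm (lp (norm (x - y)) * pos_dens y) \<le> norm (logk x y * dens y)"
        by (simp add: abs_mult)
    qed
  qed measurable
qed

text \<open>Where \<open>dens\<close> is nonnegative the upper bound on the kernel is used, where it
  is nonpositive the lower bound; so only the singularity against \<open>pos_dens\<close> survives.
  The general kernel \<open>\<kappa>\<close> covers both \<open>logk\<close> and its
  regularisation.\<close>

lemma kernel_integral_le:
  assumes int: "integrable lborel (\<lambda>y. \<kappa> y * dens y)"
    and lower: "\<And>y. - ln (1 + norm x) \<le> \<kappa> y" and upper: "\<And>y. y \<noteq> x \<Longrightarrow> \<kappa> y \<le> logk x y"
    and logpot: "integrable lborel (\<lambda>y. lp (norm (x - y)) * pos_dens y)"
  shows "(\<integral>y. \<kappa> y * dens y \<partial>lborel) \<le> logpot x + (ln 2 + ln (1 + norm x)) * abs_mass"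
proof -
  have le: "\<kappa> y * dens y \<le> lp (norm (x - y)) * pos_dens y + (ln 2 + ln (1 + norm x)) * \<bar>dens y\<bar>" if "y \<noteq> x" for y
  proof (cases "norm y < 1")
    case True
    have "ln (1 + norm y) \<le> ln 2"
      using True by (intro ln_mono) (auto intro: add_pos_nonneg)
    then have "\<kappa> y \<le> ln 2 + lp (norm (x - y))"
      using upper[OF that] unfolding logk_def lp_def by linarith
    then have "\<kappa> y * dens y \<le> (ln 2 + lp (norm (x - y))) * dens y"
      using dens_nonneg[of y] True by (intro mult_right_mono) auto
    also have "\<dots> = lp (norm (x - y)) * pos_dens y + ln 2 * \<bar>dens y\<bar>"
      using True dens_nonneg[of y] by (simp add: pos_dens_def algebra_simps)
    also have "\<dots> \<le> lp (norm (x - y)) * pos_dens y + (ln 2 + ln (1 + norm x)) * \<bar>dens y\<bar>"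
      by (intro add_left_mono mult_right_mono) auto
    finally show ?thesis .
  next
    case False
    then have "\<kappa> y * dens y \<le> - ln (1 + norm x) * dens y"
      using dens_nonpos[of y] lower by (intro mult_right_mono_neg) auto
    also have "\<dots> = ln (1 + norm x) * \<bar>dens y\<bar>"
      using dens_nonpos[of y] False by simp
    also have "\<dots> \<le> (ln 2 + ln (1 + norm x)) * \<bar>dens y\<bar>"
      by (intro mult_right_mono) auto
    finally show ?thesis using False by (simp add: pos_dens_def)
  qed
  have "(\<integral>y. \<kappa> y * dens y \<partial>lborel)
      \<le> (\<integral>y. lp (norm (x - y)) * pos_dens y + (ln 2 + ln (1 + norm x)) * \<bar>dens y\<bar> \<partial>lborel)"
    using AE_lborel_neq[of x] le dens_integrable
    by (intro integral_mono_AE int Bochner_Integration.integrable_add logpot integrable_mult_right) auto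
  also have "\<dots> = logpot x + (ln 2 + ln (1 + norm x)) * abs_mass"
    using logpot dens_integrable by (simp add: logpot_def abs_mass_def)
  finally show ?thesis .
qed

section \<open>Exponential integrability and square integrability of the positive part\<close>

text \<open>The threshold pi^2 normalises the tail of \<open>pos_dens\<close> to mass at most 1 in
  the exponent \<open>logpot x / pi\<^sup>2\<close>, which is the exponent needed to control the
  square of the density.\<close>

lemma truncation_exists:
  obtains N :: real where "N \<ge> 0" "(\<integral>y. max 0 (pos_dens y - N) \<partial>lborel) \<le> pi\<^sup>2"
proof -
  have "(\<lambda>n. \<integral>y. max 0 (pos_dens y - real n) \<partial>lborel) \<longlonglongrightarrow> (\<integral>y. (0::real) \<partial>(lborel :: (real^4) measure))"
  proof (rule integral_dominated_convergence[OF _ _ pos_dens_integrable])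
    show "AE y in lborel. (\<lambda>n. max 0 (pos_dens y - real n)) \<longlonglongrightarrow> 0"
    proof (rule AE_I2)
      fix y
      obtain n0 :: nat where "pos_dens y \<le> real n0" using real_arch_simple by blast
      then have "\<forall>n\<ge>n0. max 0 (pos_dens y - real n) = 0" by (auto simp: max_def)
      then show "(\<lambda>n. max 0 (pos_dens y - real n)) \<longlonglongrightarrow> 0"
        by (intro tendsto_eventually) (auto simp: eventually_sequentially)
    qed
    show "\<And>n. AE y in lborel. norm (max 0 (pos_dens y - real n)) \<le> pos_dens y"
      using pos_dens_nonneg by auto
  qed auto
  then have "eventually (\<lambda>n. (\<integral>y. max 0 (pos_dens y - real n) \<partial>lborel) < pi\<^sup>2) sequentially"
    by (intro order_tendstoD(2)) auto
  then obtain n where "(\<integral>y. max 0 (pos_dens y - real n) \<partial>lborel) < pi\<^sup>2"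
    by (auto simp: eventually_sequentially)
  then show thesis by (intro that[of "real n"]) auto
qed

text \<open>The integral of \<open>(pos_dens - N)\<^sup>+\<close> is so small for large \<open>N\<close> that Jensen's inequality reduces the exponential
  integrability of its logarithmic potential to the local integrability of \<open>1 / \<bar>x - y\<bar>\<close>; the bounded rest
  has a bounded potential (Brezis and Merle).\<close>

lemma exp_logpot_integrable: "integrable lborel (\<lambda>x. indicator (ball 0 1) x * exp (logpot x / pi\<^sup>2))"
proof -
  obtain N where N: "N \<ge> 0" "(\<integral>y. max 0 (pos_dens y - N) \<partial>lborel) \<le> pi\<^sup>2"
    by (rule truncation_exists)
  define f1 where "f1 = (\<lambda>y. max 0 (pos_dens y - N))"
  define f2 where "f2 = (\<lambda>y. min (pos_dens y) N)"
  have [measurable]: "f1 \<in> borel_measurable borel" "f2 \<in> borel_measurable borel"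
    unfolding f1_def f2_def by measurable
  have f1: "0 \<le> f1 y" "f1 y \<le> pos_dens y" and f2: "0 \<le> f2 y" "f2 y \<le> pos_dens y" "f2 y \<le> N"
    and f12: "f1 y + f2 y = pos_dens y" for y
    using pos_dens_nonneg[of y] N by (auto simp: f1_def f2_def)
  have f1_int: "integrable lborel f1"
    by (rule Bochner_Integration.integrable_bound[OF pos_dens_integrable]) (use f1 pos_dens_nonneg in auto)
  have pair: "integrable (lborel \<Otimes>\<^sub>M lborel) (\<lambda>(x, y). indicator (ball 0 1) x * (f1 y / norm (x - y)))"
    by (intro integrable_pair_inverse_norm f1_int emeasure_lborel_ball_finite) simp
  \<comment> \<open>The integrable majorant: the exponential factor bounds the contribution of
    \<open>f2\<close>, which is at most \<open>N\<close>; the bracket is the Jensen bound for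
    \<open>f1\<close>, integrable over the ball by Fubini.\<close>
  define G where "G = (\<lambda>x. exp (N * ball_pot / pi\<^sup>2) * (indicator (ball 0 1) x + 1 / pi\<^sup>2 *
      (indicator (ball 0 1) x * integral\<^sup>L lborel f1
       + (\<integral>y. indicator (ball 0 1) x * (f1 y / norm (x - y)) \<partial>lborel))))"
  have ind: "integrable lborel (indicator (ball (0::real^4) 1) :: _ \<Rightarrow> real)"
    using emeasure_lborel_ball_finite[of "0::real^4" 1] by (intro integrable_real_indicator) auto
  have G_int: "integrable lborel G"
    unfolding G_def
    by (intro integrable_mult_right Bochner_Integration.integrable_add integrable_mult_left ind
        lborel_pair.integrable_fst[OF pair])
  show ?thesis
  proof (rule Bochner_Integration.integrable_bound[OF G_int])
    show "AE x in lborel. norm (indicator (ball 0 1) x * exp (logpot x / pi\<^sup>2)) \<le> norm (G x)"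
      using logpot_integrable_AE lborel_pair.AE_integrable_fst[OF pair]
    proof eventually_elim
      case (elim x)
      show ?case
      proof (cases "x \<in> ball 0 1")
        case False
        then show ?thesis by simp
      next
        case True
        have i3: "integrable lborel (\<lambda>y. f1 y / norm (x - y))"
          using elim(2) True by simp
        have lp_int: "integrable lborel (\<lambda>y. lp (norm (x - y)) * h y)"
          if [measurable]: "h \<in> borel_measurable borel" and h: "\<And>y. 0 \<le> h y" "\<And>y. h y \<le> pos_dens y" for h
        proof (rule Bochner_Integration.integrable_bound[OF elim(1)])
          show "AE y in lborel. norm (lp (norm (x - y)) * h y) \<le> norm (lp (norm (x - y)) * pos_dens y)"
          proof (rule AE_I2)
            fix y
            have "lp (norm (x - y)) * h y \<le> lp (norm (x - y)) * pos_dens y"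
              by (intro mult_left_mono h lp_nonneg)
            then show "norm (lp (norm (x - y)) * h y) \<le> norm (lp (norm (x - y)) * pos_dens y)"
              using h(1)[of y] lp_nonneg[of "norm (x - y)"] pos_dens_nonneg[of y] by simp
          qed
        qed measurable
        have i1: "integrable lborel (\<lambda>y. lp (norm (x - y)) * f1 y)"
          by (rule lp_int) (use f1 in auto)
        have i2: "integrable lborel (\<lambda>y. lp (norm (x - y)) * f2 y)"
          by (rule lp_int) (use f2 in auto)
        have W12: "logpot x = (\<integral>y. lp (norm (x - y)) * f1 y \<partial>lborel) + (\<integral>y. lp (norm (x - y)) * f2 y \<partial>lborel)"
          unfolding logpot_def using i1 i2
          by (subst Bochner_Integration.integral_add[symmetric]) (auto simp: f12[symmetric] algebra_simps)
        have "(\<integral>y. lp (norm (x - y)) * f2 y \<partial>lborel) \<le> (\<integral>y. lp (norm (x - y)) * N \<partial>lborel)"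
          using f2 lp_nonneg by (intro integral_mono i2 integrable_mult_left integrable_lp mult_left_mono) auto
        also have "\<dots> \<le> N * ball_pot"
          using mult_left_mono[OF integral_lp_le[of x] N(1)] by (simp add: mult.commute)
        finally have W2: "(\<integral>y. lp (norm (x - y)) * f2 y \<partial>lborel) \<le> N * ball_pot" .
        \<comment> \<open>By the choice of \<open>N\<close> this weight has mass at most 1, as
          \<open>exp_weighted_le\<close> requires.\<close>
        define g where "g = (\<lambda>y. f1 y / pi\<^sup>2)"
        have g_int: "integrable lborel g" unfolding g_def using f1_int by simp
        have g_eq: "g y * (1 + 1 / norm (x - y)) = (f1 y + f1 y / norm (x - y)) / pi\<^sup>2" for y
          by (simp add: g_def distrib_left add_divide_distrib)
        have gb_int: "integrable lborel (\<lambda>y. g y * (1 + 1 / norm (x - y)))"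
          unfolding g_eq using f1_int i3 by simp
        have gE_le: "g y * exp (lp (norm (x - y))) \<le> g y * (1 + 1 / norm (x - y))" for y
          using f1 exp_lp_le by (intro mult_left_mono) (auto simp: g_def)
        have gE_int: "integrable lborel (\<lambda>y. g y * exp (lp (norm (x - y))))"
          by (rule Bochner_Integration.integrable_bound[OF gb_int])
            (use gE_le f1 in \<open>auto intro!: AE_I2 order.trans[OF gE_le abs_ge_self] simp: g_def abs_mult\<close>)
        have g_lp: "(\<integral>y. lp (norm (x - y)) * f1 y \<partial>lborel) / pi\<^sup>2 = (\<integral>y. g y * lp (norm (x - y)) \<partial>lborel)"
          unfolding g_def by (subst integral_divide_zero[symmetric]) (simp add: mult.commute)
        have "exp (\<integral>y. g y * lp (norm (x - y)) \<partial>lborel)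
            \<le> 1 - integral\<^sup>L lborel g + (\<integral>y. g y * exp (lp (norm (x - y))) \<partial>lborel)"
        proof (rule exp_weighted_le[OF g_int _ gE_int])
          show "integrable lborel (\<lambda>y. g y * lp (norm (x - y)))"
            using i1 unfolding g_def by (simp add: mult.commute)
          show "integral\<^sup>L lborel g \<le> 1"
            using N(2) unfolding g_def f1_def by (simp add: divide_le_eq_1)
        qed (use f1 in \<open>auto simp: g_def\<close>)
        moreover have "integral\<^sup>L lborel g \<ge> 0"
          using f1 by (intro integral_nonneg_AE) (auto simp: g_def)
        moreover have "(\<integral>y. g y * exp (lp (norm (x - y))) \<partial>lborel)
            \<le> (\<integral>y. g y * (1 + 1 / norm (x - y)) \<partial>lborel)"
          by (intro integral_mono gE_int gb_int gE_le)
        moreover have "(\<integral>y. g y * (1 + 1 / norm (x - y)) \<partial>lborel)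
            = 1 / pi\<^sup>2 * (integral\<^sup>L lborel f1 + (\<integral>y. f1 y / norm (x - y) \<partial>lborel))"
          unfolding g_eq using f1_int i3 by simp
        ultimately have e1: "exp ((\<integral>y. lp (norm (x - y)) * f1 y \<partial>lborel) / pi\<^sup>2)
            \<le> 1 + 1 / pi\<^sup>2 * (integral\<^sup>L lborel f1 + (\<integral>y. f1 y / norm (x - y) \<partial>lborel))"
          unfolding g_lp by linarith
        have "exp (logpot x / pi\<^sup>2) \<le> exp (N * ball_pot / pi\<^sup>2) * exp ((\<integral>y. lp (norm (x - y)) * f1 y \<partial>lborel) / pi\<^sup>2)"
          unfolding exp_add[symmetric] W12 using W2 
          by (simp add: add_divide_distrib divide_right_mono)
        also have "\<dots> \<le> G x"
          unfolding G_def using True e1 by simp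
        finally show ?thesis using True by simp
      qed
    qed
  qed measurable
qed

text \<open>The square of the density is at most exp(8 U) on the unit ball, and 8 times the
  prefactor 1/(8 pi^2) is exactly the 1/pi^2 of \<open>exp_logpot_integrable\<close>.\<close>

lemma pos_dens_square_integrable: "integrable lborel (\<lambda>x. (pos_dens x)\<^sup>2)"
proof (rule Bochner_Integration.integrable_bound)
  define C where "C = exp (2 * ln 2 * abs_mass / pi\<^sup>2 + 8 * c)"
  show "integrable lborel (\<lambda>x. C * (indicator (ball 0 1) x * exp (logpot x / pi\<^sup>2)))"
    by (intro integrable_mult_right exp_logpot_integrable)
  show "AE x in lborel. norm ((pos_dens x)\<^sup>2) \<le> norm (C * (indicator (ball 0 1) x * exp (logpot x / pi\<^sup>2)))"
    using logpot_integrable_AE logk_dens_integrable_AE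
  proof eventually_elim
    case (elim x)
    show ?case
    proof (cases "x \<in> ball 0 1")
      case False
      then show ?thesis by (simp add: pos_dens_def)
    next
      case True
      have "(\<integral>y. logk x y * dens y \<partial>lborel) \<le> logpot x + (ln 2 + ln (1 + norm x)) * abs_mass"
        by (rule kernel_integral_le[OF elim(2) logk_ge _ elim(1)]) auto
      also have "\<dots> \<le> logpot x + (ln 2 + ln 2) * abs_mass"
        using True abs_mass_nonneg
        by (intro add_left_mono mult_right_mono ln_mono) (auto intro: add_pos_nonneg)
      finally have "8 * U x \<le> 8 * (1 / (8 * pi\<^sup>2) * (logpot x + (ln 2 + ln 2) * abs_mass) + c)"
        unfolding U_eq_dens[of x] by (intro mult_left_mono add_right_mono) auto
      also have "\<dots> = logpot x / pi\<^sup>2 + (2 * ln 2 * abs_mass / pi\<^sup>2 + 8 * c)"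
        by (simp add: field_simps)
      finally have "exp (8 * U x) \<le> C * exp (logpot x / pi\<^sup>2)"
        unfolding C_def exp_add[symmetric] by simp
      moreover have "(pos_dens x)\<^sup>2 \<le> (exp (4 * U x))\<^sup>2"
        using True pos_dens_nonneg[of x] K_pow_le[of x]
        by (intro power_mono) (auto simp: pos_dens_def dens_def mult_left_le_one_le K_pow_nonneg)
      moreover have "(exp (4 * U x))\<^sup>2 = exp (8 * U x)"
        by (simp add: power2_eq_square exp_add[symmetric])
      ultimately show ?thesis using True by (simp add: C_def)
    qed
  qed
qed measurable

section \<open>Pointwise bounds obtained from square integrability\<close>

definition logpot_bound :: real where
  "logpot_bound = 2 * ball_pot + (\<integral>y. (pos_dens y)\<^sup>2 \<partial>lborel) / 2"

text \<open>The inequality 2ab <= a^2 + b^2 separates kernel and density, both square integrable.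
  The result holds for every \<open>x\<close> with a uniform bound, which starts the passage from
  almost everywhere to everywhere.\<close>

lemma logpot_integrable: "integrable lborel (\<lambda>y. lp (norm (x - y)) * pos_dens y)"
  and logpot_le: "logpot x \<le> logpot_bound"
proof -
  have le: "lp (norm (x - y)) * pos_dens y \<le> ((lp (norm (x - y)))\<^sup>2 + (pos_dens y)\<^sup>2) / 2" for y
    using sum_squares_bound[of "lp (norm (x - y))" "pos_dens y"] by simp
  have i: "integrable lborel (\<lambda>y. ((lp (norm (x - y)))\<^sup>2 + (pos_dens y)\<^sup>2) / 2)"
    using integrable_lp_square[of x] pos_dens_square_integrable by simp
  show 1: "integrable lborel (\<lambda>y. lp (norm (x - y)) * pos_dens y)"
    by (rule Bochner_Integration.integrable_bound[OF i])
      (use le lp_nonneg pos_dens_nonneg in \<open>auto intro!: AE_I2 simp: abs_mult\<close>)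
  show "logpot x \<le> logpot_bound"
    unfolding logpot_def using integral_mono[OF 1 i le] integral_lp_square_le[of x]
      integrable_lp_square[of x] pos_dens_square_integrable by (simp add: logpot_bound_def)
qed

text \<open>Up to a constant a power of 1 + r; it majorises exp(4 U), and later its regularisations,
  on the ball of radius r.\<close>

definition growth :: "real \<Rightarrow> real" where
  "growth r = exp (4 * (1 / (8 * pi\<^sup>2) * (logpot_bound + (ln 2 + ln (1 + r)) * abs_mass) + c))"

lemma growth_mono: "0 \<le> r \<Longrightarrow> r \<le> s \<Longrightarrow> growth r \<le> growth s"
  unfolding growth_def exp_le_cancel_iff using abs_mass_nonneg
  by (intro mult_left_mono add_mono mult_right_mono ln_mono) auto

lemma growth_pos: "0 < growth r"
  by (simp add: growth_def)

lemma kernel_growth: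
  assumes "integrable lborel (\<lambda>y. \<kappa> y * dens y)"
    and "\<And>y. - ln (1 + norm x) \<le> \<kappa> y" and "\<And>y. y \<noteq> x \<Longrightarrow> \<kappa> y \<le> logk x y"
  shows "exp (4 * (1 / (8 * pi\<^sup>2) * (\<integral>y. \<kappa> y * dens y \<partial>lborel) + c)) \<le> growth (norm x)"
  unfolding growth_def exp_le_cancel_iff
  using kernel_integral_le[OF assms logpot_integrable] logpot_le[of x]
  by (intro mult_left_mono add_right_mono) auto

lemma dens_locally_bounded: "AE y in lborel. norm y \<le> R \<longrightarrow> \<bar>dens y\<bar> \<le> (1 + R powr p) * growth R"
  using logk_dens_integrable_AE
proof eventually_elim
  case (elim x)
  show ?case
  proof
    assume x: "norm x \<le> R"
    have "exp (4 * U x) \<le> growth (norm x)"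
      unfolding U_eq_dens[of x] by (rule kernel_growth[OF elim logk_ge]) auto
    also have "\<dots> \<le> growth R" using x by (intro growth_mono) auto
    finally show "\<bar>dens x\<bar> \<le> (1 + R powr p) * growth R"
      unfolding dens_def abs_mult using abs_K_pow_le[OF x] by (intro mult_mono) auto
  qed
qed

text \<open>Near \<open>x\<close> the density is almost everywhere bounded, so 1/|x - y| is
  integrable against it; at distance at least 1 the kernel is at most 1. This works for every
  \<open>x\<close>.\<close>

lemma dens_div_norm_integrable: "integrable lborel (\<lambda>y. dens y / norm (x - y))"
proof (rule Bochner_Integration.integrable_bound)
  define B where "B = (1 + (norm x + 1) powr p) * growth (norm x + 1)"
  show "integrable lborel (\<lambda>y. \<bar>dens y\<bar> + B * (indicator (ball x 1) y * (1 / norm (x - y))))"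
    by (intro Bochner_Integration.integrable_add integrable_mult_right integrable_inverse_norm_ball
        integrable_abs dens_integrable)
  have B0: "B \<ge> 0" unfolding B_def using growth_pos less_imp_le by (intro mult_nonneg_nonneg) auto
  show "AE y in lborel. norm (dens y / norm (x - y))
      \<le> norm (\<bar>dens y\<bar> + B * (indicator (ball x 1) y * (1 / norm (x - y))))"
    using dens_locally_bounded[of "norm x + 1"]
  proof eventually_elim
    case (elim y)
    show ?case
    proof (cases "y \<in> ball x 1")
      case True
      then have "norm y \<le> norm x + 1"
        using norm_triangle_ineq2[of y x] by (simp add: dist_norm norm_minus_commute)
      then have "\<bar>dens y\<bar> \<le> B" using elim by (simp add: B_def)
      then have "\<bar>dens y\<bar> / norm (x - y) \<le> B / norm (x - y)"
        by (intro divide_right_mono) auto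
      then show ?thesis using True B0 by simp
    next
      case False
      then have "norm (x - y) \<ge> 1" by (simp add: dist_norm)
      then have "\<bar>dens y\<bar> / norm (x - y) \<le> \<bar>dens y\<bar> / 1"
        by (intro divide_left_mono) auto
      then show ?thesis using False by simp
    qed
  qed
qed measurable

text \<open>Upgrades the almost-everywhere convergence assumed in the locale to every point, by
  comparing \<open>logk\<close> with 1/|x - y|.\<close>

lemma logk_dens_integrable: "integrable lborel (\<lambda>y. logk x y * dens y)"
proof (rule Bochner_Integration.integrable_bound)
  show "integrable lborel (\<lambda>y. ln (1 + norm x) * \<bar>dens y\<bar> + (1 + norm x) * \<bar>dens y / norm (x - y)\<bar>)"
    by (intro Bochner_Integration.integrable_add integrable_mult_right
        integrable_abs dens_integrable dens_div_norm_integrable)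
  show "AE y in lborel. norm (logk x y * dens y)
      \<le> norm (ln (1 + norm x) * \<bar>dens y\<bar> + (1 + norm x) * \<bar>dens y / norm (x - y)\<bar>)"
  proof (rule AE_I2)
    fix y
    have "\<bar>logk x y\<bar> * \<bar>dens y\<bar> \<le> (ln (1 + norm x) + (1 + norm x) / norm (x - y)) * \<bar>dens y\<bar>"
      by (intro mult_right_mono abs_logk_le) auto
    also have "\<dots> = ln (1 + norm x) * \<bar>dens y\<bar> + (1 + norm x) * \<bar>dens y / norm (x - y)\<bar>"
      by (simp add: distrib_right)
    finally show "norm (logk x y * dens y)
        \<le> norm (ln (1 + norm x) * \<bar>dens y\<bar> + (1 + norm x) * \<bar>dens y / norm (x - y)\<bar>)"
      by (simp add: abs_mult)
  qed
qed measurable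

lemma exp_U_le: "exp (4 * U x) \<le> growth (norm x)"
  unfolding U_eq_dens[of x] by (rule kernel_growth[OF logk_dens_integrable logk_ge]) auto

definition pow_dens :: "real^4 \<Rightarrow> real" where
  "pow_dens x = norm x powr p * exp (4 * U x)"

lemma pow_dens_measurable[measurable]: "pow_dens \<in> borel_measurable borel"
  unfolding pow_dens_def by measurable

lemma pow_dens_nonneg: "0 \<le> pow_dens x"
  by (simp add: pow_dens_def)

text \<open>For |x| >= 2 the factor |x|^p is comparable to |x|^p - 1, so \<open>dens\<close>
  dominates; inside the ball of radius 2 everything is bounded.\<close>

lemma pow_dens_integrable: "integrable lborel pow_dens"
proof (rule Bochner_Integration.integrable_bound)
  \<comment> \<open>The function s/(s - 1) decreases for s > 1, so its value at s = 2^p bounds it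
    for all |x| >= 2.\<close>
  define C where "C = 2 powr p / (2 powr p - 1)"
  have gt1: "2 powr p > 1" using p_pos by simp
  then have C0: "C \<ge> 0" by (simp add: C_def)
  have ind: "integrable lborel (indicator (ball (0::real^4) 2) :: _ \<Rightarrow> real)"
    using emeasure_lborel_ball_finite[of "0::real^4" 2] by (intro integrable_real_indicator) auto
  show "integrable lborel (\<lambda>x. C * \<bar>dens x\<bar> + 2 powr p * growth 2 * indicator (ball 0 2) x)"
    by (intro Bochner_Integration.integrable_add integrable_mult_right integrable_abs dens_integrable ind)
  show "AE x in lborel. norm (pow_dens x) \<le> norm (C * \<bar>dens x\<bar> + 2 powr p * growth 2 * indicator (ball 0 2) x)"
  proof (rule AE_I2)
    fix x :: "real^4"
    have "pow_dens x \<le> C * \<bar>dens x\<bar> + 2 powr p * growth 2 * indicator (ball 0 2) x"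
    proof (cases "x \<in> ball 0 2")
      case True
      then have "exp (4 * U x) \<le> growth 2"
        using order.trans[OF exp_U_le growth_mono] by simp
      then have "pow_dens x \<le> 2 powr p * growth 2"
        unfolding pow_dens_def using True p_pos by (intro mult_mono powr_mono2) auto
      then show ?thesis using True C0 by (simp add: add_increasing)
    next
      case False
      then have n: "2 powr p \<le> norm x powr p" using p_pos by (intro powr_mono2) auto
      then have "norm x powr p \<le> C * (norm x powr p - 1)"
        using gt1 by (simp add: C_def field_simps)
      then have "pow_dens x \<le> C * (norm x powr p - 1) * exp (4 * U x)"
        unfolding pow_dens_def by (intro mult_right_mono) auto
      also have "\<dots> = C * \<bar>dens x\<bar>"
        using n gt1 by (simp add: dens_def K_pow_def abs_mult)
      finally show ?thesis using False by simp
    qed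
    then show "norm (pow_dens x) \<le> norm (C * \<bar>dens x\<bar> + 2 powr p * growth 2 * indicator (ball 0 2) x)"
      using pow_dens_nonneg[of x] by simp
  qed
qed measurable

end

section \<open>Regularised potentials\<close>

definition logk_reg :: "real \<Rightarrow> real^4 \<Rightarrow> real^4 \<Rightarrow> real" where
  "logk_reg e x y = ln (1 + norm y) - ln ((norm (x - y))\<^sup>2 + e\<^sup>2) / 2"

text \<open>For e > 0 this is minus the radial derivative of \<open>logk_reg e\<close> in
  \<open>x\<close>. At e = 0 it is the singular kernel, equal to 0 on the diagonal.\<close>

definition rad :: "real \<Rightarrow> real^4 \<Rightarrow> real^4 \<Rightarrow> real" where
  "rad e x y = (x \<bullet> (x - y)) / ((norm (x - y))\<^sup>2 + e\<^sup>2)"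

lemma logk_reg_measurable[measurable]: "case_prod (logk_reg e) \<in> borel_measurable (borel \<Otimes>\<^sub>M borel)"
  unfolding logk_reg_def by measurable

lemma rad_measurable[measurable]: "case_prod (rad e) \<in> borel_measurable (borel \<Otimes>\<^sub>M borel)"
  unfolding rad_def by measurable

text \<open>The restriction e <= 1 lets e^2 be absorbed into (1 + |x| + |y|)^2, giving the same
  lower bound as for \<open>logk\<close>.\<close>

lemma logk_reg_ge:
  assumes "0 < e" "e \<le> 1"
  shows "- ln (1 + norm x) \<le> logk_reg e x y"
proof -
  have "(norm (x - y))\<^sup>2 + e\<^sup>2 \<le> (norm x + norm y)\<^sup>2 + 1"
    using assms norm_triangle_ineq4[of x y] by (intro add_mono power_mono power_le_one) auto
  also have "\<dots> \<le> (1 + norm x + norm y)\<^sup>2"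
    by (simp add: power2_eq_square algebra_simps)
  also have "\<dots> \<le> ((1 + norm x) * (1 + norm y))\<^sup>2"
    by (intro power_mono one_plus_norm_mult_le) auto
  finally have "ln ((norm (x - y))\<^sup>2 + e\<^sup>2) \<le> ln (((1 + norm x) * (1 + norm y))\<^sup>2)"
    using assms by (intro ln_mono) (auto intro: add_nonneg_pos)
  also have "\<dots> = 2 * (ln (1 + norm x) + ln (1 + norm y))"
    by (subst ln_realpow) (auto simp: ln_mult_pos add_pos_nonneg)
  finally show ?thesis by (simp add: logk_reg_def)
qed

lemma logk_reg_le:
  assumes "y \<noteq> x"
  shows "logk_reg e x y \<le> logk x y"
proof -
  have "2 * ln (norm (x - y)) = ln ((norm (x - y))\<^sup>2)"
    using assms by (subst ln_realpow) auto
  also have "\<dots> \<le> ln ((norm (x - y))\<^sup>2 + e\<^sup>2)"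
    using assms by (intro ln_mono) auto
  finally show ?thesis by (simp add: logk_reg_def logk_def)
qed

lemma abs_logk_reg_le:
  assumes "0 < e" "e \<le> 1" "y \<noteq> x"
  shows "\<bar>logk_reg e x y\<bar> \<le> ln (1 + norm x) + (1 + norm x) / norm (x - y)"
proof -
  have "0 \<le> ln (1 + norm x)" "0 \<le> (1 + norm x) / norm (x - y)"
    by (auto intro!: divide_nonneg_nonneg)
  then show ?thesis
    using logk_reg_ge[OF assms(1,2), of x y] logk_reg_le[OF assms(3), of e] logk_le[OF assms(3)[symmetric]]
    by linarith
qed

text \<open>Uniform in \<open>e\<close>, including e = 0: this is the dominating function when the
  regularisation is removed.\<close>

lemma abs_rad_le: "\<bar>rad e x y\<bar> \<le> norm x / norm (x - y)"
proof (cases "x = y")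
  case False
  then have s: "norm (x - y) > 0" by simp
  have "\<bar>rad e x y\<bar> = \<bar>x \<bullet> (x - y)\<bar> / ((norm (x - y))\<^sup>2 + e\<^sup>2)"
    by (simp add: rad_def)
  also have "\<dots> \<le> (norm x * norm (x - y)) / (norm (x - y))\<^sup>2"
    using s by (intro frac_le Cauchy_Schwarz_ineq2) auto
  also have "\<dots> = norm x / norm (x - y)"
    using s by (simp add: power2_eq_square)
  finally show ?thesis .
qed (simp add: rad_def)

text \<open>From e|z| <= |z|^2 + e^2. The bound degenerates as e tends to 0 but does not depend on
  \<open>z\<close>, so it allows differentiation under the integral for fixed
  \<open>e\<close>.\<close>

lemma inner_div_norm_square_le:
  fixes x z :: "'a::real_inner"
  assumes "0 < e"
  shows "\<bar>x \<bullet> z\<bar> / ((norm z)\<^sup>2 + e\<^sup>2) \<le> norm x / e"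
proof -
  have pos: "(norm z)\<^sup>2 + e\<^sup>2 > 0" using assms by (intro add_nonneg_pos) auto
  have "norm z * e \<le> (norm z)\<^sup>2 + e\<^sup>2"
    using sum_squares_bound[of "norm z" e] mult_nonneg_nonneg[OF norm_ge_zero[of z] less_imp_le[OF assms]]
    by linarith
  then have "norm x * (norm z * e) \<le> norm x * ((norm z)\<^sup>2 + e\<^sup>2)"
    by (intro mult_left_mono) auto
  moreover have "\<bar>x \<bullet> z\<bar> * e \<le> (norm x * norm z) * e"
    using assms by (intro mult_right_mono Cauchy_Schwarz_ineq2) auto
  ultimately have "\<bar>x \<bullet> z\<bar> * e \<le> norm x * ((norm z)\<^sup>2 + e\<^sup>2)"
    by (simp add: mult.assoc)
  then show ?thesis using pos assms by (simp add: field_simps)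
qed

text \<open>Along a ray the squared distance is a quadratic polynomial in \<open>t\<close>, and e^2
  keeps the argument of the logarithm positive. All \<open>t\<close> are covered because the mean
  value bound below needs them.\<close>

lemma logk_reg_radial_derivative:
  assumes "0 < e"
  shows "((\<lambda>t. logk_reg e (t *\<^sub>R x) y) has_real_derivative
      - ((x \<bullet> (t *\<^sub>R x - y)) / ((norm (t *\<^sub>R x - y))\<^sup>2 + e\<^sup>2))) (at t)"
proof -
  have eq: "(norm (t *\<^sub>R x - y))\<^sup>2 = t\<^sup>2 * (x \<bullet> x) - 2 * t * (x \<bullet> y) + y \<bullet> y" for t
    unfolding power2_norm_eq_inner
    by (simp add: inner_diff_left inner_diff_right inner_commute power2_eq_square algebra_simps)
  have pos: "t\<^sup>2 * (x \<bullet> x) - 2 * t * (x \<bullet> y) + y \<bullet> y + e\<^sup>2 > 0"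
    unfolding eq[symmetric] using assms by (intro add_nonneg_pos) auto
  have "((\<lambda>t. t\<^sup>2 * (x \<bullet> x) - 2 * t * (x \<bullet> y) + y \<bullet> y + e\<^sup>2)
      has_real_derivative 2 * t * (x \<bullet> x) - 2 * (x \<bullet> y)) (at t)"
    by (auto intro!: derivative_eq_intros)
  from DERIV_diff[OF DERIV_const[of "ln (1 + norm y)"]
      DERIV_cdivide[OF DERIV_chain2[OF DERIV_ln_divide[OF pos] this], of 2]]
  have "((\<lambda>t. ln (1 + norm y) - ln (t\<^sup>2 * (x \<bullet> x) - 2 * t * (x \<bullet> y) + y \<bullet> y + e\<^sup>2) / 2)
      has_real_derivative
      - ((2 * t * (x \<bullet> x) - 2 * (x \<bullet> y)) / (t\<^sup>2 * (x \<bullet> x) - 2 * t * (x \<bullet> y) + y \<bullet> y + e\<^sup>2) / 2)) (at t)"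
    by simp
  moreover have "(2 * t * (x \<bullet> x) - 2 * (x \<bullet> y)) / D / 2 = (x \<bullet> (t *\<^sub>R x - y)) / D" for D
    by (simp add: inner_diff_right diff_divide_distrib)
  ultimately show ?thesis
    unfolding logk_reg_def eq by (simp only:)
qed

lemma logk_reg_radial_lipschitz:
  assumes "0 < e"
  shows "\<bar>logk_reg e (t *\<^sub>R x) y - logk_reg e (s *\<^sub>R x) y\<bar> \<le> norm x / e * \<bar>t - s\<bar>"
proof -
  have "norm (logk_reg e (t *\<^sub>R x) y - logk_reg e (s *\<^sub>R x) y) \<le> norm x / e * norm (t - s)"
  proof (rule field_differentiable_bound[OF convex_UNIV])
    show "((\<lambda>t. logk_reg e (t *\<^sub>R x) y) has_field_derivative
      - ((x \<bullet> (z *\<^sub>R x - y)) / ((norm (z *\<^sub>R x - y))\<^sup>2 + e\<^sup>2))) (at z within UNIV)" for z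
      using logk_reg_radial_derivative[OF assms] by simp
    show "norm (- ((x \<bullet> (z *\<^sub>R x - y)) / ((norm (z *\<^sub>R x - y))\<^sup>2 + e\<^sup>2))) \<le> norm x / e" for z
      using inner_div_norm_square_le[OF assms, of x "z *\<^sub>R x - y"] by simp
  qed auto
  then show ?thesis by simp
qed

section \<open>A Lipschitz cutoff and elementary Lipschitz estimates\<close>

definition tent :: "real \<Rightarrow> real^4 \<Rightarrow> real" where
  "tent R x = max 0 (1 - norm x / R)"

text \<open>The radial derivative \<open>x \<bullet> \<nabla>\<close> of \<open>tent\<close>, valid off the sphere of radius \<open>R\<close>.\<close>

definition tent' :: "real \<Rightarrow> real^4 \<Rightarrow> real" where
  "tent' R x = (if norm x < R then - norm x / R else 0)"

lemma tent_measurable[measurable]: "tent R \<in> borel_measurable borel"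
  unfolding tent_def by measurable

lemma tent'_measurable[measurable]: "tent' R \<in> borel_measurable borel"
  unfolding tent'_def by measurable

lemma tent_nonneg: "0 \<le> tent R x"
  by (simp add: tent_def)

lemma tent_le: "R > 0 \<Longrightarrow> tent R x \<le> 1"
  by (simp add: tent_def)

lemma tent_eq_0: "R > 0 \<Longrightarrow> norm x \<ge> R \<Longrightarrow> tent R x = 0"
  by (simp add: tent_def)

lemma abs_tent'_le: "R > 0 \<Longrightarrow> \<bar>tent' R x\<bar> \<le> 1"
  by (simp add: tent'_def)

lemma tent_lipschitz:
  assumes "R > 0"
  shows "\<bar>tent R x - tent R y\<bar> \<le> norm (x - y) / R"
proof -
  have "\<bar>tent R x - tent R y\<bar> \<le> \<bar>norm x / R - norm y / R\<bar>"
    unfolding tent_def by linarith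
  also have "\<dots> = \<bar>norm x - norm y\<bar> / R"
    using assms by (simp flip: diff_divide_distrib)
  also have "\<dots> \<le> norm (x - y) / R"
    using assms by (intro divide_right_mono norm_triangle_ineq3) auto
  finally show ?thesis .
qed

lemma tent_radial_derivative:
  assumes "R > 0" "norm x \<noteq> R"
  shows "((\<lambda>t. tent R (t *\<^sub>R x)) has_real_derivative tent' R x) (at 1)"
proof (cases "norm x < R")
  case True
  show ?thesis
  proof (rule has_field_derivative_transform_within_open)
    show "((\<lambda>t. 1 - t * norm x / R) has_real_derivative tent' R x) (at 1)"
      using True by (auto intro!: derivative_eq_intros simp: tent'_def)
    show "open ({0<..} \<inter> {t. t * norm x < R})"
      by (intro open_Int open_Collect_less continuous_intros)
    show "1 - t * norm x / R = tent R (t *\<^sub>R x)" if "t \<in> {0<..} \<inter> {t. t * norm x < R}" for t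
      using that assms by (simp add: tent_def max_def)
  qed (use True in auto)
next
  case False
  show ?thesis
  proof (rule has_field_derivative_transform_within_open)
    show "((\<lambda>t. 0) has_real_derivative tent' R x) (at 1)"
      using False by (simp add: tent'_def)
    show "open ({0<..} \<inter> {t. R < t * norm x})"
      by (intro open_Int open_Collect_less continuous_intros)
    show "0 = tent R (t *\<^sub>R x)" if "t \<in> {0<..} \<inter> {t. R < t * norm x}" for t
      using that assms by (simp add: tent_def max_def)
  qed (use False assms in auto)
qed

lemma abs_mult_diff_le:
  fixes a b a' b' :: real
  assumes "\<bar>a - a'\<bar> \<le> La" "\<bar>b - b'\<bar> \<le> Lb" "\<bar>a\<bar> \<le> A" "\<bar>b'\<bar> \<le> B"
  shows "\<bar>a * b - a' * b'\<bar> \<le> A * Lb + B * La"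
proof -
  have "a * b - a' * b' = a * (b - b') + b' * (a - a')" by (simp add: algebra_simps)
  then have "\<bar>a * b - a' * b'\<bar> \<le> \<bar>a\<bar> * \<bar>b - b'\<bar> + \<bar>b'\<bar> * \<bar>a - a'\<bar>"
    by (metis abs_mult abs_triangle_ineq)
  also have "\<dots> \<le> A * Lb + B * La"
    using assms by (intro add_mono mult_mono) auto
  finally show ?thesis .
qed

text \<open>Convexity: the slope of a chord of the exponential is at most the derivative at its
  right end.\<close>

lemma abs_exp_diff_le:
  assumes "exp a \<le> G" "exp b \<le> (G::real)"
  shows "\<bar>exp a - exp b\<bar> \<le> G * \<bar>a - b\<bar>"
proof -
  have *: "exp u - exp v \<le> G * (u - v)" if "v \<le> u" "exp u \<le> G" for u v :: real
  proof -
    have "exp u * (1 + (v - u)) \<le> exp u * exp (v - u)"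
      by (intro mult_left_mono exp_ge_add_one_self) auto
    then have "exp u - exp v \<le> exp u * (u - v)"
      by (simp add: exp_diff algebra_simps)
    also have "\<dots> \<le> G * (u - v)" using that by (intro mult_right_mono) auto
    finally show ?thesis .
  qed
  show ?thesis
    using *[of a b] *[of b a] assms by (cases "a \<le> b") auto
qed

text \<open>For z >= 1 the bound z^(p-1) <= z^p <= 2^p treats p < 1 and p >= 1 alike.\<close>

lemma powr_minus_one_le:
  assumes "0 < p" "1 \<le> t" "t \<le> (2::real)"
  shows "\<bar>t powr p - 1\<bar> \<le> p * 2 powr p * (t - 1)"
proof -
  have "norm (t powr p - 1 powr p) \<le> p * 2 powr p * norm (t - 1)"
  proof (rule field_differentiable_bound[where S="{1..2}" and f'="\<lambda>t. p * t powr (p - 1)"])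
    show "((\<lambda>t. t powr p) has_field_derivative p * z powr (p - 1)) (at z within {1..2})"
      if "z \<in> {1..2}" for z
      using that by (intro has_real_derivative_powr[THEN DERIV_subset]) auto
    show "norm (p * z powr (p - 1)) \<le> p * 2 powr p" if "z \<in> {1..2}" for z
    proof -
      have "z powr (p - 1) \<le> z powr p" using that by (intro powr_mono) auto
      also have "\<dots> \<le> 2 powr p" using that assms by (intro powr_mono2) auto
      finally show ?thesis using assms by (simp add: abs_mult)
    qed
  qed (use assms in auto)
  then show ?thesis using assms by simp
qed

section \<open>The regularised solution and its radial derivative\<close>

context normal_potential
begin

definition U_reg :: "real \<Rightarrow> real^4 \<Rightarrow> real" where
  "U_reg e x = 1 / (8 * pi\<^sup>2) * (\<integral>y. logk_reg e x y * dens y \<partial>lborel) + c"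

text \<open>For 0 < e <= 1 this is the radial derivative of \<open>U_reg e\<close>; at e = 0 it is
  defined through the singular kernel directly, with no claim that \<open>U\<close> is
  differentiable.\<close>

definition D_reg :: "real \<Rightarrow> real^4 \<Rightarrow> real" where
  "D_reg e x = - 1 / (8 * pi\<^sup>2) * (\<integral>y. rad e x y * dens y \<partial>lborel)"

lemma U_reg_measurable[measurable]: "U_reg e \<in> borel_measurable borel"
  unfolding U_reg_def by measurable

lemma D_reg_measurable[measurable]: "D_reg e \<in> borel_measurable borel"
  unfolding D_reg_def by measurable

lemma kernel_bound_integrable:
  "integrable lborel (\<lambda>y. (ln (1 + norm x) + (1 + norm x) / norm (x - y)) * \<bar>dens y\<bar>)"
proof -
  have eq: "(ln (1 + norm x) + (1 + norm x) / norm (x - y)) * \<bar>dens y\<bar>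
      = ln (1 + norm x) * \<bar>dens y\<bar> + (1 + norm x) * \<bar>dens y / norm (x - y)\<bar>" for y
    by (simp add: distrib_right)
  show ?thesis
    unfolding eq
    by (intro Bochner_Integration.integrable_add integrable_mult_right
        integrable_abs dens_integrable dens_div_norm_integrable)
qed

lemma abs_logk_reg_dens_le:
  assumes "0 < e" "e \<le> 1"
  shows "AE y in lborel. norm (logk_reg e x y * dens y)
      \<le> (ln (1 + norm x) + (1 + norm x) / norm (x - y)) * \<bar>dens y\<bar>"
  using AE_lborel_neq[of x]
proof eventually_elim
  case (elim y)
  then show ?case
    unfolding real_norm_def abs_mult by (intro mult_right_mono abs_logk_reg_le assms) auto
qed

lemma logk_reg_dens_integrable:
  assumes "0 < e" "e \<le> 1"
  shows "integrable lborel (\<lambda>y. logk_reg e x y * dens y)"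
  by (rule Bochner_Integration.integrable_bound[OF kernel_bound_integrable[of x]])
    (use abs_logk_reg_dens_le[OF assms, of x] in \<open>auto elim!: eventually_mono intro: order.trans[OF _ abs_ge_self]\<close>)

lemma exp_U_reg_le:
  assumes "0 < e" "e \<le> 1"
  shows "exp (4 * U_reg e x) \<le> growth (norm x)"
  unfolding U_reg_def
  by (rule kernel_growth[OF logk_reg_dens_integrable[OF assms] logk_reg_ge[OF assms] logk_reg_le])

lemma U_reg_radial_lipschitz:
  assumes "0 < e" "e \<le> 1"
  shows "\<bar>U_reg e (t *\<^sub>R x) - U_reg e (s *\<^sub>R x)\<bar> \<le> norm x / e * abs_mass * \<bar>t - s\<bar>"
proof -
  have "\<bar>(\<integral>y. logk_reg e (t *\<^sub>R x) y * dens y \<partial>lborel) - (\<integral>y. logk_reg e (s *\<^sub>R x) y * dens y \<partial>lborel)\<bar>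
      = \<bar>\<integral>y. logk_reg e (t *\<^sub>R x) y * dens y - logk_reg e (s *\<^sub>R x) y * dens y \<partial>lborel\<bar>"
    by (subst Bochner_Integration.integral_diff) (auto intro!: logk_reg_dens_integrable assms)
  also have "\<dots> \<le> (\<integral>y. \<bar>logk_reg e (t *\<^sub>R x) y * dens y - logk_reg e (s *\<^sub>R x) y * dens y\<bar> \<partial>lborel)"
    by (rule integral_abs_bound)
  also have "\<dots> \<le> (\<integral>y. norm x / e * \<bar>t - s\<bar> * \<bar>dens y\<bar> \<partial>lborel)"
  proof (intro integral_mono)
    show "integrable lborel (\<lambda>y. \<bar>logk_reg e (t *\<^sub>R x) y * dens y - logk_reg e (s *\<^sub>R x) y * dens y\<bar>)"
      by (intro integrable_abs Bochner_Integration.integrable_diff logk_reg_dens_integrable assms)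
    show "integrable lborel (\<lambda>y. norm x / e * \<bar>t - s\<bar> * \<bar>dens y\<bar>)"
      by (intro integrable_mult_right integrable_abs dens_integrable)
    show "\<bar>logk_reg e (t *\<^sub>R x) y * dens y - logk_reg e (s *\<^sub>R x) y * dens y\<bar> \<le> norm x / e * \<bar>t - s\<bar> * \<bar>dens y\<bar>" for y
      unfolding left_diff_distrib[symmetric] abs_mult
      by (intro mult_right_mono logk_reg_radial_lipschitz assms) auto
  qed
  also have "\<dots> = norm x / e * abs_mass * \<bar>t - s\<bar>"
    by (simp add: abs_mass_def)
  finally have *: "\<bar>(\<integral>y. logk_reg e (t *\<^sub>R x) y * dens y \<partial>lborel) - (\<integral>y. logk_reg e (s *\<^sub>R x) y * dens y \<partial>lborel)\<bar>
      \<le> norm x / e * abs_mass * \<bar>t - s\<bar>" .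
  have "U_reg e (t *\<^sub>R x) - U_reg e (s *\<^sub>R x) = 1 / (8 * pi\<^sup>2) *
      ((\<integral>y. logk_reg e (t *\<^sub>R x) y * dens y \<partial>lborel) - (\<integral>y. logk_reg e (s *\<^sub>R x) y * dens y \<partial>lborel))"
    by (simp add: U_reg_def right_diff_distrib diff_divide_distrib)
  then have "\<bar>U_reg e (t *\<^sub>R x) - U_reg e (s *\<^sub>R x)\<bar> = 1 / (8 * pi\<^sup>2) *
      \<bar>(\<integral>y. logk_reg e (t *\<^sub>R x) y * dens y \<partial>lborel) - (\<integral>y. logk_reg e (s *\<^sub>R x) y * dens y \<partial>lborel)\<bar>"
    by (simp add: abs_mult)
  also have "\<dots> \<le> 1 * (norm x / e * abs_mass * \<bar>t - s\<bar>)"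
  proof (intro mult_mono *)
    have "pi * pi > 1 * 1" using pi_gt3 by (intro mult_strict_mono) auto
    then show "1 / (8 * pi\<^sup>2) \<le> 1" by (simp add: divide_le_eq_1 power2_eq_square)
  qed auto
  finally show ?thesis by simp
qed

text \<open>Differentiation under the integral: the difference quotients of the kernel are at most
  |x|/e, so |dens| dominates. Sequences replace the continuous limit to fit dominated
  convergence.\<close>

lemma U_reg_radial_derivative:
  assumes e: "0 < e" "e \<le> 1"
  shows "((\<lambda>t. U_reg e (t *\<^sub>R x)) has_real_derivative D_reg e x) (at 1)"
  unfolding has_field_derivative_iff tendsto_at_iff_sequentially
proof (intro allI impI)
  fix T :: "nat \<Rightarrow> real"
  assume T: "\<forall>i. T i \<in> UNIV - {1}" and T1: "T \<longlonglongrightarrow> 1"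
  define q where "q = (\<lambda>t y. (logk_reg e (t *\<^sub>R x) y - logk_reg e x y) / (t - 1))"
  have [measurable]: "q t \<in> borel_measurable borel" for t
    unfolding q_def by measurable
  have "(\<lambda>i. \<integral>y. q (T i) y * dens y \<partial>lborel) \<longlonglongrightarrow> (\<integral>y. - rad e x y * dens y \<partial>lborel)"
  proof (rule integral_dominated_convergence)
    show "integrable lborel (\<lambda>y. norm x / e * \<bar>dens y\<bar>)"
      by (intro integrable_mult_right integrable_abs dens_integrable)
    show "AE y in lborel. (\<lambda>i. q (T i) y * dens y) \<longlonglongrightarrow> - rad e x y * dens y"
    proof (intro AE_I2 tendsto_mult_right)
      fix y
      have "((\<lambda>t. logk_reg e (t *\<^sub>R x) y) has_real_derivative - rad e x y) (at 1)"
        using logk_reg_radial_derivative[OF e(1), of x y 1] by (simp add: rad_def)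
      then have "((\<lambda>t. q t y) \<longlongrightarrow> - rad e x y) (at 1)"
        by (simp add: has_field_derivative_iff q_def)
      then show "(\<lambda>i. q (T i) y) \<longlonglongrightarrow> - rad e x y"
        using T T1 by (auto simp: tendsto_at_iff_sequentially o_def)
    qed
    show "AE y in lborel. norm (q (T i) y * dens y) \<le> norm x / e * \<bar>dens y\<bar>" for i
    proof (rule AE_I2)
      fix y
      have ne: "T i \<noteq> 1" using T by auto
      have "\<bar>q (T i) y\<bar> \<le> norm x / e"
        using logk_reg_radial_lipschitz[OF e(1), of "T i" x y 1] ne
        by (simp add: q_def pos_divide_le_eq)
      then show "norm (q (T i) y * dens y) \<le> norm x / e * \<bar>dens y\<bar>"
        unfolding real_norm_def abs_mult by (intro mult_right_mono) auto
    qed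
  qed measurable
  then have lim: "(\<lambda>i. 1 / (8 * pi\<^sup>2) * (\<integral>y. q (T i) y * dens y \<partial>lborel)) \<longlonglongrightarrow>
      1 / (8 * pi\<^sup>2) * (\<integral>y. - rad e x y * dens y \<partial>lborel)"
    by (rule tendsto_mult_left)
  have "(\<integral>y. q t y * dens y \<partial>lborel)
      = ((\<integral>y. logk_reg e (t *\<^sub>R x) y * dens y \<partial>lborel) - (\<integral>y. logk_reg e x y * dens y \<partial>lborel)) / (t - 1)" for t
    unfolding q_def
    by (subst Bochner_Integration.integral_diff[symmetric])
      (auto intro!: logk_reg_dens_integrable e Bochner_Integration.integral_cong
        simp: left_diff_distrib simp flip: integral_divide_zero)
  then have "(U_reg e (t *\<^sub>R x) - U_reg e (1 *\<^sub>R x)) / (t - 1) = 1 / (8 * pi\<^sup>2) * (\<integral>y. q t y * dens y \<partial>lborel)" for t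
    by (simp add: U_reg_def right_diff_distrib diff_divide_distrib)
  then show "((\<lambda>y. (U_reg e (y *\<^sub>R x) - U_reg e (1 *\<^sub>R x)) / (y - 1)) \<circ> T) \<longlonglongrightarrow> D_reg e x"
    using lim by (simp add: o_def D_reg_def)
qed

end

section \<open>The Pohozaev identity\<close>

lemma AE_lborel_norm_neq: "AE x in lborel. norm (x::'a::euclidean_space) \<noteq> R"
proof (rule AE_I')
  show "sphere (0::'a) R \<in> null_sets lborel"
    using negligible_sphere[of "0::'a" R]
    by (auto simp: null_sets_completion_iff negligible_iff_null_sets)
qed auto

lemma rad_swap_sum:
  "a *\<^sub>R x \<bullet> (x - y) / (norm (x - y))\<^sup>2 + b *\<^sub>R y \<bullet> (y - x) / (norm (y - x))\<^sup>2
    = (a *\<^sub>R x - b *\<^sub>R y) \<bullet> (x - y) / (norm (x - y))\<^sup>2"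
  for x y :: "'a::real_inner"
  by (simp add: norm_minus_commute[of y x] inner_diff_left inner_diff_right
      flip: add_divide_distrib)

text \<open>The factor |x|/R from differentiating the cutoff is at most 1 on its support, so the
  constant 2 is independent of \<open>R\<close>. By symmetry the cutoff difference multiplies the
  point of smaller norm; if that point lies outside the support, both terms vanish.\<close>

lemma tent_field_lipschitz:
  assumes "R > 0"
  shows "norm (tent R x *\<^sub>R x - tent R y *\<^sub>R y) \<le> 2 * norm (x - y)"
proof -
  have *: "norm (tent R x *\<^sub>R x - tent R y *\<^sub>R y) \<le> 2 * norm (x - y)"
    if le: "norm x \<le> norm y" for x y
  proof (cases "norm x \<le> R")
    case True
    have "tent R x *\<^sub>R x - tent R y *\<^sub>R y = tent R y *\<^sub>R (x - y) + (tent R x - tent R y) *\<^sub>R x"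
      by (simp add: algebra_simps)
    then have "norm (tent R x *\<^sub>R x - tent R y *\<^sub>R y)
        \<le> norm (tent R y *\<^sub>R (x - y)) + norm ((tent R x - tent R y) *\<^sub>R x)"
      by (metis norm_triangle_ineq)
    also have "\<dots> = tent R y * norm (x - y) + \<bar>tent R x - tent R y\<bar> * norm x"
      by (simp add: tent_nonneg)
    also have "\<dots> \<le> 1 * norm (x - y) + norm (x - y) / R * R"
      using True assms by (intro add_mono mult_mono tent_lipschitz tent_le) (auto simp: tent_nonneg)
    finally show ?thesis using assms by simp
  next
    case False
    then show ?thesis using le assms by (simp add: tent_eq_0)
  qed
  show ?thesis
    using *[of x y] *[of y x] by (cases "norm x \<le> norm y") (auto simp: norm_minus_commute)
qed

text \<open>The kernel left by symmetrisation: bounded by 2 uniformly in R > 0, and tending to 1 off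
  the diagonal as \<open>R\<close> grows.\<close>

definition tent_kernel :: "real \<Rightarrow> real^4 \<Rightarrow> real^4 \<Rightarrow> real" where
  "tent_kernel R x y = (tent R x *\<^sub>R x - tent R y *\<^sub>R y) \<bullet> (x - y) / (norm (x - y))\<^sup>2"

lemma tent_kernel_measurable[measurable]: "case_prod (tent_kernel R) \<in> borel_measurable (borel \<Otimes>\<^sub>M borel)"
  unfolding tent_kernel_def by measurable

lemma abs_tent_kernel_le:
  assumes "R > 0"
  shows "\<bar>tent_kernel R x y\<bar> \<le> 2"
proof (cases "x = y")
  case False
  have "\<bar>(tent R x *\<^sub>R x - tent R y *\<^sub>R y) \<bullet> (x - y)\<bar>
      \<le> norm (tent R x *\<^sub>R x - tent R y *\<^sub>R y) * norm (x - y)"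
    by (rule Cauchy_Schwarz_ineq2)
  also have "\<dots> \<le> (2 * norm (x - y)) * norm (x - y)"
    using assms by (intro mult_right_mono tent_field_lipschitz) auto
  finally show ?thesis
    using False by (simp add: tent_kernel_def pos_divide_le_eq power2_eq_square)
qed (simp add: tent_kernel_def)

lemma tent_tendsto: "(\<lambda>n. tent (real (Suc n)) x) \<longlonglongrightarrow> 1"
proof -
  have "(\<lambda>n. max 0 (1 - norm x * inverse (real (Suc n)))) \<longlonglongrightarrow> max 0 (1 - norm x * 0)"
    by (intro tendsto_intros LIMSEQ_inverse_real_of_nat)
  then show ?thesis by (simp add: tent_def divide_inverse)
qed

lemma tent'_tendsto: "(\<lambda>n. tent' (real (Suc n)) x) \<longlonglongrightarrow> 0"
proof (rule Lim_null_comparison)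
  show "eventually (\<lambda>n. norm (tent' (real (Suc n)) x) \<le> norm x * inverse (real (Suc n))) sequentially"
    by (auto simp: tent'_def divide_inverse)
  show "(\<lambda>n. norm x * inverse (real (Suc n))) \<longlonglongrightarrow> 0"
    using tendsto_mult_right_zero[OF LIMSEQ_inverse_real_of_nat] .
qed

lemma tent_kernel_tendsto: "(\<lambda>n. tent_kernel (real (Suc n)) x y) \<longlonglongrightarrow> (if x = y then 0 else 1)"
proof (cases "x = y")
  case False
  have "(\<lambda>n. tent_kernel (real (Suc n)) x y) \<longlonglongrightarrow> (1 *\<^sub>R x - 1 *\<^sub>R y) \<bullet> (x - y) / (norm (x - y))\<^sup>2"
    unfolding tent_kernel_def using False by (intro tendsto_intros tent_tendsto) auto
  then show ?thesis using False by (simp add: power2_norm_eq_inner)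
qed (simp add: tent_kernel_def)

definition eps :: "nat \<Rightarrow> real" where
  "eps n = inverse (real (Suc n))"

lemma eps: "0 < eps n" "eps n \<le> 1" and eps_tendsto: "eps \<longlonglongrightarrow> 0"
  using LIMSEQ_inverse_real_of_nat by (auto simp: eps_def[abs_def] inverse_le_1_iff)

lemma cball_integrable: "integrable lborel (indicator (cball (0::real^4) R) :: _ \<Rightarrow> real)"
  using emeasure_lborel_cball_finite[of "0::real^4" R] by (intro integrable_real_indicator) auto

lemma cball_borel[measurable]: "cball (a::real^4) r \<in> sets borel"
  by simp

section \<open>Limits of the regularised quantities and the dilation identity\<close>

context normal_potential
begin

lemma U_reg_tendsto: "(\<lambda>n. U_reg (eps n) x) \<longlonglongrightarrow> U x"
proof -
  have "(\<lambda>n. \<integral>y. logk_reg (eps n) x y * dens y \<partial>lborel) \<longlonglongrightarrow> (\<integral>y. logk x y * dens y \<partial>lborel)"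
  proof (rule integral_dominated_convergence[OF _ _ kernel_bound_integrable[of x]])
    show "AE y in lborel. (\<lambda>n. logk_reg (eps n) x y * dens y) \<longlonglongrightarrow> logk x y * dens y"
      using AE_lborel_neq[of x]
    proof eventually_elim
      case (elim y)
      then have pos: "(norm (x - y))\<^sup>2 + 0\<^sup>2 \<noteq> 0" by simp
      have "(\<lambda>n. logk_reg (eps n) x y) \<longlonglongrightarrow> ln (1 + norm y) - ln ((norm (x - y))\<^sup>2 + 0\<^sup>2) / 2"
        unfolding logk_reg_def using pos by (intro tendsto_intros eps_tendsto) auto
      moreover have "ln ((norm (x - y))\<^sup>2 + 0\<^sup>2) / 2 = ln (norm (x - y))"
        using elim by (simp add: ln_realpow)
      ultimately show ?case by (intro tendsto_mult_right) (simp add: logk_def)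
    qed
    show "AE y in lborel. norm (logk_reg (eps n) x y * dens y)
        \<le> (ln (1 + norm x) + (1 + norm x) / norm (x - y)) * \<bar>dens y\<bar>" for n
      by (rule abs_logk_reg_dens_le[OF eps])
  qed measurable
  then show ?thesis
    unfolding U_reg_def U_eq_dens[of x] by (intro tendsto_intros)
qed

text \<open>Dominates every \<open>D_reg e x\<close> up to the factor |x|; it is unweighted by any
  cutoff but integrable over balls.\<close>

definition riesz :: "real^4 \<Rightarrow> real" where
  "riesz x = (\<integral>y. \<bar>dens y\<bar> / norm (x - y) \<partial>lborel)"

lemma riesz_measurable[measurable]: "riesz \<in> borel_measurable borel"
  unfolding riesz_def by measurable

lemma abs_dens_div_norm_integrable: "integrable lborel (\<lambda>y. \<bar>dens y\<bar> / norm (x - y))"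
  using integrable_abs[OF dens_div_norm_integrable[of x]] by simp

lemma rad_dens_integrable: "integrable lborel (\<lambda>y. rad e x y * dens y)"
  and abs_rad_dens_le: "\<bar>rad e x y * dens y\<bar> \<le> norm x * (\<bar>dens y\<bar> / norm (x - y))"
proof -
  have le: "\<bar>rad e x y * dens y\<bar> \<le> norm x * (\<bar>dens y\<bar> / norm (x - y))" for y
    using mult_right_mono[OF abs_rad_le[of e x y], of "\<bar>dens y\<bar>"] by (simp add: abs_mult)
  then show "\<bar>rad e x y * dens y\<bar> \<le> norm x * (\<bar>dens y\<bar> / norm (x - y))" .
  have i: "integrable lborel (\<lambda>y. norm x * (\<bar>dens y\<bar> / norm (x - y)))"
    by (intro integrable_mult_right abs_dens_div_norm_integrable)
  show "integrable lborel (\<lambda>y. rad e x y * dens y)"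
    by (rule Bochner_Integration.integrable_bound[OF i])
      (use order.trans[OF le abs_ge_self] in \<open>auto intro!: AE_I2\<close>)
qed

lemma D_reg_tendsto: "(\<lambda>n. D_reg (eps n) x) \<longlonglongrightarrow> D_reg 0 x"
proof -
  have "(\<lambda>n. \<integral>y. rad (eps n) x y * dens y \<partial>lborel) \<longlonglongrightarrow> (\<integral>y. rad 0 x y * dens y \<partial>lborel)"
  proof (rule integral_dominated_convergence)
    show "integrable lborel (\<lambda>y. norm x * (\<bar>dens y\<bar> / norm (x - y)))"
      by (intro integrable_mult_right abs_dens_div_norm_integrable)
    show "AE y in lborel. (\<lambda>n. rad (eps n) x y * dens y) \<longlonglongrightarrow> rad 0 x y * dens y"
      using AE_lborel_neq[of x]
    proof eventually_elim
      case (elim y)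
      then show ?case
        unfolding rad_def by (intro tendsto_intros eps_tendsto) auto
    qed
    show "AE y in lborel. norm (rad (eps n) x y * dens y) \<le> norm x * (\<bar>dens y\<bar> / norm (x - y))" for n
      unfolding real_norm_def by (intro AE_I2 abs_rad_dens_le)
  qed measurable
  then show ?thesis
    unfolding D_reg_def by (intro tendsto_intros)
qed

lemma abs_D_reg_le: "\<bar>D_reg e x\<bar> \<le> norm x * riesz x"
proof -
  have "\<bar>\<integral>y. rad e x y * dens y \<partial>lborel\<bar> \<le> (\<integral>y. \<bar>rad e x y * dens y\<bar> \<partial>lborel)"
    by (rule integral_abs_bound)
  also have "\<dots> \<le> (\<integral>y. norm x * (\<bar>dens y\<bar> / norm (x - y)) \<partial>lborel)"
    by (intro integral_mono integrable_abs rad_dens_integrable integrable_mult_right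
        abs_dens_div_norm_integrable abs_rad_dens_le)
  also have "\<dots> = norm x * riesz x"
    unfolding riesz_def by (rule integral_mult_right_zero)
  finally have *: "\<bar>\<integral>y. rad e x y * dens y \<partial>lborel\<bar> \<le> norm x * riesz x" .
  have "\<bar>D_reg e x\<bar> = 1 / (8 * pi\<^sup>2) * \<bar>\<integral>y. rad e x y * dens y \<partial>lborel\<bar>"
    by (simp add: D_reg_def abs_mult)
  also have "\<dots> \<le> 1 * (norm x * riesz x)"
  proof (intro mult_mono *)
    have "pi * pi > 1 * 1" using pi_gt3 by (intro mult_strict_mono) auto
    then show "1 / (8 * pi\<^sup>2) \<le> 1" by (simp add: divide_le_eq_1 power2_eq_square)
  qed auto
  finally show ?thesis by simp
qed

lemma K_pow_radial_derivative:
  "((\<lambda>t. K_pow p (t *\<^sub>R x)) has_real_derivative - (p * norm x powr p)) (at 1)"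
proof (rule has_field_derivative_transform_within_open)
  show "((\<lambda>t. 1 - t powr p * norm x powr p) has_real_derivative - (p * norm x powr p)) (at 1)"
    by (auto intro!: derivative_eq_intros)
  show "1 - t powr p * norm x powr p = K_pow p (t *\<^sub>R x)" if "t \<in> {0<..}" for t
    using that by (simp add: K_pow_def powr_mult)
qed auto

text \<open>This is \<open>4 g + x \<bullet> \<nabla>g\<close> for \<open>g = tent R * K_pow p * exp (4 * U_reg e)\<close>, off the sphere of radius \<open>R\<close>.\<close>

definition radial_density :: "real \<Rightarrow> real \<Rightarrow> real^4 \<Rightarrow> real" where
  "radial_density e R x =
    (4 * tent R x * K_pow p x + tent' R x * K_pow p x - p * tent R x * norm x powr p) * exp (4 * U_reg e x)
    + 4 * (tent R x * K_pow p x * exp (4 * U_reg e x) * D_reg e x)"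

text \<open>Differentiates \<open>t\<^sup>4 \<integral> g (t x) dx\<close>, which does not depend on \<open>t\<close>, at \<open>t = 1\<close>.\<close>

lemma radial_identity:
  assumes e: "0 < e" "e \<le> 1" and R: "R > 0"
  shows "integral\<^sup>L lborel (radial_density e R) = 0"
proof -
  define g where "g = (\<lambda>x. tent R x * K_pow p x * exp (4 * U_reg e x))"
  define g' where "g' = (\<lambda>x. radial_density e R x - 4 * g x)"
  have [measurable]: "g \<in> borel_measurable borel" "g' \<in> borel_measurable borel"
    unfolding g_def g'_def radial_density_def by measurable
  have g_int: "integrable lborel g"
  proof (rule Bochner_Integration.integrable_bound)
    show "integrable lborel (\<lambda>x. (1 + R powr p) * growth R * indicator (cball (0::real^4) R) x)"
      by (intro integrable_mult_right cball_integrable)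
    show "AE x in lborel. norm (g x) \<le> norm ((1 + R powr p) * growth R * indicator (cball (0::real^4) R) x)"
    proof (rule AE_I2)
      fix x :: "real^4"
      show "norm (g x) \<le> norm ((1 + R powr p) * growth R * indicator (cball (0::real^4) R) x)"
      proof (cases "norm x \<le> R")
        case True
        have "exp (4 * U_reg e x) \<le> growth R"
          using exp_U_reg_le[OF e, of x] growth_mono[OF norm_ge_zero True] by linarith
        then have "\<bar>tent R x\<bar> * \<bar>K_pow p x\<bar> * exp (4 * U_reg e x) \<le> 1 * (1 + R powr p) * growth R"
          using abs_K_pow_le[OF True] tent_le[OF R, of x] tent_nonneg[of R x] 
          by (intro mult_mono) auto
        then show ?thesis using True growth_pos[of R] by (simp add: g_def abs_mult)
      next
        case False
        then show ?thesis using R by (simp add: g_def tent_eq_0)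
      qed
    qed
  qed measurable
  \<comment> \<open>Lipschitz constant of a product along a ray: the bound for cutoff times
    \<open>K_pow\<close> multiplies the Lipschitz constant of the exponential, and the bound for the
    exponential multiplies that of cutoff times \<open>K_pow\<close>.\<close>
  define C where "C = (1 + (2 * R) powr p) * (growth (2 * R) * (4 * (R / e * abs_mass)))
      + growth (2 * R) * (1 * (R powr p * (p * 2 powr p)) + (1 + R powr p) * 1)"
  \<comment> \<open>Only t > 1 is used: a point outside the ball of radius \<open>R\<close> is then
    moved further out, so the difference vanishes there. The bound t <= 2 keeps dilated points
    within radius 2R.\<close>
  have lip: "\<bar>g (t *\<^sub>R x) - g x\<bar> \<le> C * indicator (cball 0 R) x * (t - 1)"
    if t: "1 < t" "t \<le> 2" for t x
  proof (cases "norm x \<le> R")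
    case False
    have "1 * norm x \<le> t * norm x" using t by (intro mult_right_mono) auto
    then show ?thesis using False R t by (simp add: g_def tent_eq_0)
  next
    case True
    have tx: "norm (t *\<^sub>R x) \<le> 2 * R" 
      using t True R by (simp add: mult_mono)
    have d: "t *\<^sub>R x - x = (t - 1) *\<^sub>R x" by (simp add: algebra_simps)
    have T: "\<bar>tent R (t *\<^sub>R x) - tent R x\<bar> \<le> 1 * (t - 1)"
    proof -
      have "\<bar>tent R (t *\<^sub>R x) - tent R x\<bar> \<le> (t - 1) * norm x / R"
        using tent_lipschitz[OF R, of "t *\<^sub>R x" x] t by (simp add: d)
      also have "\<dots> \<le> (t - 1) * R / R"
        using True R t by (intro divide_right_mono mult_left_mono) auto
      finally show ?thesis using R by simp
    qed
    have K: "\<bar>K_pow p (t *\<^sub>R x) - K_pow p x\<bar> \<le> R powr p * (p * 2 powr p) * (t - 1)"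
    proof -
      have "K_pow p (t *\<^sub>R x) - K_pow p x = - (norm x powr p * (t powr p - 1))"
        using t by (simp add: K_pow_def powr_mult algebra_simps)
      then have "\<bar>K_pow p (t *\<^sub>R x) - K_pow p x\<bar> = norm x powr p * \<bar>t powr p - 1\<bar>"
        by (simp add: abs_mult)
      also have "\<dots> \<le> R powr p * (p * 2 powr p * (t - 1))"
        using True p_pos t by (intro mult_mono powr_mono2 powr_minus_one_le) auto
      finally show ?thesis by (simp add: mult.assoc)
    qed
    have E1: "exp (4 * U_reg e (t *\<^sub>R x)) \<le> growth (2 * R)"
      using exp_U_reg_le[OF e, of "t *\<^sub>R x"] growth_mono[OF norm_ge_zero tx] by linarith
    have E2: "exp (4 * U_reg e x) \<le> growth (2 * R)"
    proof -
      have "norm x \<le> 2 * R" using True R by linarith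
      then show ?thesis by (intro order.trans[OF exp_U_reg_le[OF e] growth_mono]) auto
    qed
    have E: "\<bar>exp (4 * U_reg e (t *\<^sub>R x)) - exp (4 * U_reg e x)\<bar>
        \<le> growth (2 * R) * (4 * (R / e * abs_mass)) * (t - 1)"
    proof -
      have "\<bar>U_reg e (t *\<^sub>R x) - U_reg e x\<bar> \<le> norm x / e * abs_mass * (t - 1)"
        using U_reg_radial_lipschitz[OF e, of t x 1] t by simp
      also have "\<dots> \<le> R / e * abs_mass * (t - 1)"
        using True e abs_mass_nonneg t by (intro mult_right_mono divide_right_mono) auto
      finally have u: "\<bar>4 * U_reg e (t *\<^sub>R x) - 4 * U_reg e x\<bar> \<le> 4 * (R / e * abs_mass) * (t - 1)"
        by linarith
      have "\<bar>exp (4 * U_reg e (t *\<^sub>R x)) - exp (4 * U_reg e x)\<bar>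
          \<le> growth (2 * R) * \<bar>4 * U_reg e (t *\<^sub>R x) - 4 * U_reg e x\<bar>"
        by (rule abs_exp_diff_le[OF E1 E2])
      also have "\<dots> \<le> growth (2 * R) * (4 * (R / e * abs_mass) * (t - 1))"
        using u growth_pos[of "2 * R"] by (intro mult_left_mono) auto
      finally show ?thesis by (simp add: mult.assoc)
    qed
    have t1: "\<bar>tent R (t *\<^sub>R x)\<bar> \<le> 1" using R by (simp add: tent_nonneg tent_le)
    have TK: "\<bar>tent R (t *\<^sub>R x) * K_pow p (t *\<^sub>R x) - tent R x * K_pow p x\<bar>
        \<le> 1 * (R powr p * (p * 2 powr p) * (t - 1)) + (1 + R powr p) * (1 * (t - 1))"
      by (rule abs_mult_diff_le[OF T K t1 abs_K_pow_le[OF True]])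
    have TK1: "\<bar>tent R (t *\<^sub>R x) * K_pow p (t *\<^sub>R x)\<bar> \<le> 1 * (1 + (2 * R) powr p)"
      unfolding abs_mult by (intro mult_mono t1 abs_K_pow_le tx) auto
    have "\<bar>g (t *\<^sub>R x) - g x\<bar> \<le> 1 * (1 + (2 * R) powr p) * (growth (2 * R) * (4 * (R / e * abs_mass)) * (t - 1))
        + growth (2 * R) * (1 * (R powr p * (p * 2 powr p) * (t - 1)) + (1 + R powr p) * (1 * (t - 1)))"
      unfolding g_def by (rule abs_mult_diff_le[OF TK E TK1]) (use E2 in simp)
    also have "\<dots> = C * (t - 1)"
      by (simp add: C_def algebra_simps)
    finally show ?thesis using True by simp
  qed
  \<comment> \<open>Dilation factors approach 1 from above, as \<open>lip\<close> requires.\<close>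
  define T where "T = (\<lambda>n. 1 + eps n)"
  have T: "1 < T n" "T n \<le> 2" for n using eps[of n] by (auto simp: T_def)
  have T_lim: "T \<longlonglongrightarrow> 1"
    unfolding T_def using tendsto_add[OF tendsto_const eps_tendsto, of 1] by simp
  have gT_int: "integrable lborel (\<lambda>x. g (T n *\<^sub>R x))" for n
    using integrable_lborel_scale[OF g_int, of "T n"] T[of n] by simp
  have meas: "(\<lambda>x. (g (T n *\<^sub>R x) - g x) / (T n - 1)) \<in> borel_measurable lborel" for n
    by measurable
  have lim_ae: "AE x in lborel. (\<lambda>n. (g (T n *\<^sub>R x) - g x) / (T n - 1)) \<longlonglongrightarrow> g' x"
    using AE_lborel_norm_neq[of R]
  proof eventually_elim
    case (elim x)
    have "((\<lambda>t. tent R (t *\<^sub>R x) * K_pow p (t *\<^sub>R x) * exp (4 * U_reg e (t *\<^sub>R x)))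
        has_real_derivative g' x) (at 1)"
      by (rule derivative_eq_intros tent_radial_derivative[OF R elim] K_pow_radial_derivative
          U_reg_radial_derivative[OF e] refl)+
        (simp add: g'_def radial_density_def g_def algebra_simps)
    then have "((\<lambda>t. (g (t *\<^sub>R x) - g x) / (t - 1)) \<longlongrightarrow> g' x) (at 1)"
      by (simp add: has_field_derivative_iff g_def)
    then show ?case
      using T(1) T_lim unfolding tendsto_at_iff_sequentially
      by (auto simp: o_def dest!: spec[of _ T]) (metis order_less_irrefl)
  qed
  have bound: "AE x in lborel. norm ((g (T n *\<^sub>R x) - g x) / (T n - 1)) \<le> C * indicator (cball 0 R) x" for n
    using lip[OF T] T[of n] by (intro AE_I2) (simp add: abs_divide pos_divide_le_eq)
  have C_int: "integrable lborel (\<lambda>x. C * indicator (cball (0::real^4) R) x)"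
    by (intro integrable_mult_right cball_integrable)
  have lim1: "(\<lambda>n. \<integral>x. (g (T n *\<^sub>R x) - g x) / (T n - 1) \<partial>lborel) \<longlonglongrightarrow> integral\<^sup>L lborel g'"
    by (rule integral_dominated_convergence[OF _ meas C_int lim_ae bound]) measurable
  have g'_int: "integrable lborel g'"
    by (rule integrable_dominated_convergence[OF _ meas C_int lim_ae bound]) measurable
  \<comment> \<open>Scaling in dimension 4 turns the integrated difference quotient into that of
    t^(-4), times the integral of \<open>g\<close>.\<close>
  have quot: "(\<integral>x. (g (T n *\<^sub>R x) - g x) / (T n - 1) \<partial>lborel)
      = (inverse (T n ^ 4) - 1) / (T n - 1) * integral\<^sup>L lborel g" for n
  proof -
    have "integral\<^sup>L lborel g = T n ^ 4 * (\<integral>x. g (T n *\<^sub>R x) \<partial>lborel)"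
      using integral_lborel_scale[OF g_int, of "T n"] T[of n] by simp
    then have "(\<integral>x. g (T n *\<^sub>R x) \<partial>lborel) = inverse (T n ^ 4) * integral\<^sup>L lborel g"
      using T[of n] by simp
    then show ?thesis
      using gT_int[of n] g_int by (simp add: left_diff_distrib)
  qed
  have "(\<lambda>n. (inverse (T n ^ 4) - 1) / (T n - 1) * integral\<^sup>L lborel g) \<longlonglongrightarrow> -4 * integral\<^sup>L lborel g"
  proof (rule tendsto_mult_right)
    have "((\<lambda>t::real. inverse (t ^ 4)) has_real_derivative -4) (at 1)"
      by (auto intro!: derivative_eq_intros)
    then have "((\<lambda>t::real. (inverse (t ^ 4) - 1) / (t - 1)) \<longlongrightarrow> -4) (at 1)"
      by (simp add: has_field_derivative_iff)
    then show "(\<lambda>n. (inverse (T n ^ 4) - 1) / (T n - 1)) \<longlonglongrightarrow> -4"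
      using T(1) T_lim unfolding tendsto_at_iff_sequentially
      by (auto simp: o_def dest!: spec[of _ T]) (metis order_less_irrefl)
  qed
  then have "integral\<^sup>L lborel g' = -4 * integral\<^sup>L lborel g"
    by (rule LIMSEQ_unique[OF lim1[unfolded quot]])
  moreover have "radial_density e R = (\<lambda>x. g' x + 4 * g x)"
    by (simp add: g'_def)
  ultimately show ?thesis
    using g'_int g_int by simp
qed

end

lemma integrable_pair_mult:
  fixes g h :: "'a::euclidean_space \<Rightarrow> real"
  assumes g: "integrable lborel g" and h: "integrable lborel h"
  shows "integrable (lborel \<Otimes>\<^sub>M lborel) (\<lambda>(x, y). g x * h y)"
proof (rule lborel_pair.Fubini_integrable)
  have [measurable]: "g \<in> borel_measurable borel" "h \<in> borel_measurable borel"
    using g h by auto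
  show "(\<lambda>(x, y). g x * h y) \<in> borel_measurable (lborel \<Otimes>\<^sub>M lborel)"
    by measurable
  have "(\<integral>y. norm (case (x, y) of (x, y) \<Rightarrow> g x * h y) \<partial>lborel) = \<bar>g x\<bar> * (\<integral>y. \<bar>h y\<bar> \<partial>lborel)" for x
    by (simp add: abs_mult)
  then show "integrable lborel (\<lambda>x. \<integral>y. norm (case (x, y) of (x, y) \<Rightarrow> g x * h y) \<partial>lborel)"
    using g by simp
qed (use h in auto)

context normal_potential
begin

lemma radial_density_measurable[measurable]: "radial_density e R \<in> borel_measurable borel"
  unfolding radial_density_def by measurable

text \<open>Passes to the limit e -> 0 in \<open>radial_identity\<close>. The cutoff confines the
  problem to a ball, where \<open>growth\<close> bounds the exponentials and \<open>riesz\<close>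
  the radial derivatives.\<close>

lemma tent_identity_U:
  assumes R: "R > 0"
  shows "(\<integral>x. (4 * tent R x * K_pow p x + tent' R x * K_pow p x - p * tent R x * norm x powr p) * exp (4 * U x)
    + 4 * (tent R x * K_pow p x * exp (4 * U x) * D_reg 0 x) \<partial>lborel) = 0"
proof -
  let ?lim = "\<lambda>x. (4 * tent R x * K_pow p x + tent' R x * K_pow p x - p * tent R x * norm x powr p) * exp (4 * U x)
    + 4 * (tent R x * K_pow p x * exp (4 * U x) * D_reg 0 x)"
  \<comment> \<open>The 5 is 4 + 1, from the \<open>tent\<close> and \<open>tent'\<close> terms
    containing \<open>K_pow\<close>.\<close>
  define A where "A = 5 * (1 + R powr p) + p * R powr p"
  have Rp: "0 \<le> R powr p" by simp
  have V0: "0 \<le> riesz x" for x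
    unfolding riesz_def by (intro integral_nonneg_AE) auto
  have "integrable lborel (\<lambda>x. \<integral>y. indicator (cball 0 R) x * (\<bar>dens y\<bar> / norm (x - y)) \<partial>lborel)"
    by (rule lborel_pair.integrable_fst[OF integrable_pair_inverse_norm[OF integrable_abs[OF dens_integrable]]])
      (use emeasure_lborel_cball_finite[of "0::real^4" R] in simp_all)
  then have V_int: "integrable lborel (\<lambda>x. indicator (cball 0 R) x * riesz x)"
    unfolding riesz_def by (subst integral_mult_right_zero[symmetric])
  have "(\<lambda>n. integral\<^sup>L lborel (radial_density (eps n) R)) \<longlonglongrightarrow> integral\<^sup>L lborel ?lim"
  proof (rule integral_dominated_convergence)
    show "integrable lborel (\<lambda>x. A * growth R * indicator (cball (0::real^4) R) x
        + 4 * (1 + R powr p) * growth R * R * (indicator (cball 0 R) x * riesz x))"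
      by (intro Bochner_Integration.integrable_add integrable_mult_right cball_integrable V_int)
    show "AE x in lborel. (\<lambda>n. radial_density (eps n) R x) \<longlonglongrightarrow> ?lim x"
      unfolding radial_density_def by (intro AE_I2 tendsto_intros U_reg_tendsto D_reg_tendsto)
    show "AE x in lborel. norm (radial_density (eps n) R x) \<le> A * growth R * indicator (cball (0::real^4) R) x
        + 4 * (1 + R powr p) * growth R * R * (indicator (cball 0 R) x * riesz x)" for n
    proof (rule AE_I2)
      fix x :: "real^4"
      show "norm (radial_density (eps n) R x) \<le> A * growth R * indicator (cball (0::real^4) R) x
        + 4 * (1 + R powr p) * growth R * R * (indicator (cball 0 R) x * riesz x)"
      proof (cases "norm x \<le> R")
        case False
        then show ?thesis using R by (simp add: radial_density_def tent_eq_0 tent'_def)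
      next
        case True
        have G: "exp (4 * U_reg (eps n) x) \<le> growth R"
          by (rule order.trans[OF exp_U_reg_le[OF eps] growth_mono[OF norm_ge_zero True]])
        have t: "\<bar>tent R x\<bar> \<le> 1" using R by (simp add: tent_nonneg tent_le)
        have K: "\<bar>K_pow p x\<bar> \<le> 1 + R powr p" by (rule abs_K_pow_le[OF True])
        have a1: "\<bar>tent R x * K_pow p x\<bar> \<le> 1 * (1 + R powr p)"
          unfolding abs_mult by (intro mult_mono t K) auto
        have a2: "\<bar>tent' R x * K_pow p x\<bar> \<le> 1 * (1 + R powr p)"
          unfolding abs_mult by (intro mult_mono abs_tent'_le R K) auto
        have a3: "\<bar>tent R x * norm x powr p\<bar> \<le> 1 * R powr p"
          unfolding abs_mult using True p_pos t by (intro mult_mono) (auto intro: powr_mono2)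
        have a3': "\<bar>p * tent R x * norm x powr p\<bar> \<le> p * R powr p"
          using mult_left_mono[OF a3, of p] p_pos by (simp add: abs_mult mult.assoc)
        have "\<bar>4 * tent R x * K_pow p x + tent' R x * K_pow p x - p * tent R x * norm x powr p\<bar> \<le> A"
          using a1 a2 a3' unfolding A_def by (simp add: mult.assoc)
        then have b1: "\<bar>(4 * tent R x * K_pow p x + tent' R x * K_pow p x - p * tent R x * norm x powr p)
            * exp (4 * U_reg (eps n) x)\<bar> \<le> A * growth R"
          unfolding abs_mult using G by (intro mult_mono) auto
        have "\<bar>tent R x * K_pow p x\<bar> * exp (4 * U_reg (eps n) x) * \<bar>D_reg (eps n) x\<bar>
            \<le> (1 * (1 + R powr p)) * growth R * (R * riesz x)"
        proof (intro mult_mono a1 G)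
          show "\<bar>D_reg (eps n) x\<bar> \<le> R * riesz x"
            using abs_D_reg_le[of "eps n" x] mult_right_mono[OF True V0[of x]] by linarith
        qed (use growth_pos[of R] in auto)
        then have b2: "\<bar>4 * (tent R x * K_pow p x * exp (4 * U_reg (eps n) x) * D_reg (eps n) x)\<bar>
            \<le> 4 * (1 + R powr p) * growth R * R * riesz x"
          by (simp add: abs_mult algebra_simps)
        have "norm (radial_density (eps n) R x) \<le> A * growth R + 4 * (1 + R powr p) * growth R * R * riesz x"
          unfolding radial_density_def real_norm_def using b1 b2 by (intro order.trans[OF abs_triangle_ineq] add_mono)
        then show ?thesis using True by simp
      qed
    qed
  qed measurable
  moreover have "integral\<^sup>L lborel (radial_density (eps n) R) = 0" for n
    by (rule radial_identity[OF eps R])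
  ultimately show ?thesis
    using LIMSEQ_unique[OF _ tendsto_const[of 0]] by simp
qed

lemma tent_times_integrable:
  assumes "integrable lborel h" "R > 0"
  shows "integrable lborel (\<lambda>x. tent R x * h x)" "integrable lborel (\<lambda>x. tent' R x * h x)"
proof -
  have [measurable]: "h \<in> borel_measurable borel" using assms by auto
  have "\<bar>a\<bar> * \<bar>h x\<bar> \<le> \<bar>h x\<bar>" if "\<bar>a\<bar> \<le> 1" for a x
    using mult_right_mono[OF that, of "\<bar>h x\<bar>"] by simp
  then show "integrable lborel (\<lambda>x. tent R x * h x)" "integrable lborel (\<lambda>x. tent' R x * h x)"
    using assms(2)
    by (auto intro!: Bochner_Integration.integrable_bound[OF assms(1)] AE_I2
        simp: abs_mult tent_nonneg tent_le abs_tent'_le mult_left_le_one_le)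
qed

text \<open>Symmetrisation in \<open>x\<close> and \<open>y\<close> turns the singular kernel \<open>x \<bullet> (x - y) / \<bar>x - y\<bar>\<^sup>2\<close> into a bounded one.\<close>

lemma tent_D_reg:
  assumes R: "R > 0"
  shows "integrable lborel (\<lambda>x. tent R x * dens x * D_reg 0 x)"
    and "(\<integral>x. tent R x * dens x * D_reg 0 x \<partial>lborel)
      = - 1 / (16 * pi\<^sup>2) * (\<integral>(x, y). dens x * dens y * tent_kernel R x y \<partial>(lborel \<Otimes>\<^sub>M lborel))"
proof -
  define h where "h = (\<lambda>(x, y). tent R x * dens x * (rad 0 x y * dens y))"
  have [measurable]: "h \<in> borel_measurable (borel \<Otimes>\<^sub>M borel)"
    unfolding h_def by measurable
  \<comment> \<open>Bounds \<open>dens x\<close> on the ball together with the factor |x| <= R from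
    the bound on \<open>rad\<close>.\<close>
  define C where "C = (1 + R powr p) * growth R * R"
  have C0: "0 \<le> C"
    unfolding C_def using R growth_pos[of R] by (intro mult_nonneg_nonneg) auto
  have pair: "integrable (lborel \<Otimes>\<^sub>M lborel) (\<lambda>(x, y). indicator (cball 0 R) x * (C * \<bar>dens y\<bar> / norm (x - y)))"
    by (intro integrable_pair_inverse_norm integrable_mult_right integrable_abs dens_integrable)
      (use emeasure_lborel_cball_finite[of "0::real^4" R] in simp_all)
  have h_int: "integrable (lborel \<Otimes>\<^sub>M lborel) h"
  proof (rule Bochner_Integration.integrable_bound[OF pair])
    show "AE xy in lborel \<Otimes>\<^sub>M lborel. norm (h xy)
        \<le> norm (case xy of (x, y) \<Rightarrow> indicator (cball 0 R) x * (C * \<bar>dens y\<bar> / norm (x - y)))"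
    proof (rule AE_I2, clarify)
      fix x y :: "real^4"
      show "norm (h (x, y)) \<le> norm (indicator (cball 0 R) x * (C * \<bar>dens y\<bar> / norm (x - y)))"
      proof (cases "norm x \<le> R")
        case False
        then show ?thesis using R by (simp add: h_def tent_eq_0)
      next
        case True
        have t: "\<bar>tent R x\<bar> \<le> 1" using R by (simp add: tent_nonneg tent_le)
        have "exp (4 * U x) \<le> growth R"
          by (rule order.trans[OF exp_U_le growth_mono[OF norm_ge_zero True]])
        then have "\<bar>dens x\<bar> \<le> (1 + R powr p) * growth R"
          unfolding dens_def abs_mult using abs_K_pow_le[OF True] by (intro mult_mono) auto
        moreover have "\<bar>rad 0 x y * dens y\<bar> \<le> R * (\<bar>dens y\<bar> / norm (x - y))"
          using abs_rad_dens_le[of 0 x y] mult_right_mono[OF True, of "\<bar>dens y\<bar> / norm (x - y)"] by simp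
        ultimately have "\<bar>tent R x\<bar> * \<bar>dens x\<bar> * \<bar>rad 0 x y * dens y\<bar>
            \<le> 1 * ((1 + R powr p) * growth R) * (R * (\<bar>dens y\<bar> / norm (x - y)))"
          using t growth_pos[of R] by (intro mult_mono) auto
        also have "\<dots> = C * \<bar>dens y\<bar> / norm (x - y)" by (simp add: C_def)
        finally show ?thesis using True C0 by (simp add: h_def abs_mult)
      qed
    qed
  qed measurable
  have inner: "(\<integral>y. h (x, y) \<partial>lborel) = - (8 * pi\<^sup>2) * (tent R x * dens x * D_reg 0 x)" for x
    by (simp add: h_def D_reg_def)
  show "integrable lborel (\<lambda>x. tent R x * dens x * D_reg 0 x)"
    using lborel_pair.integrable_fst'[OF h_int] unfolding inner by simp
  have eq: "- (8 * pi\<^sup>2) * (\<integral>x. tent R x * dens x * D_reg 0 x \<partial>lborel) = integral\<^sup>L (lborel \<Otimes>\<^sub>M lborel) h"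
    using lborel_pair.integral_fst'[OF h_int] unfolding inner by simp
  have swap: "integral\<^sup>L (lborel \<Otimes>\<^sub>M lborel) (\<lambda>(x, y). h (y, x)) = integral\<^sup>L (lborel \<Otimes>\<^sub>M lborel) h"
    by (rule lborel_pair.integral_product_swap) simp
  have sum: "h (x, y) + h (y, x) = dens x * dens y * tent_kernel R x y" for x y
  proof -
    have "h (x, y) + h (y, x) = dens x * dens y * (tent R x *\<^sub>R x \<bullet> (x - y) / (norm (x - y))\<^sup>2
        + tent R y *\<^sub>R y \<bullet> (y - x) / (norm (y - x))\<^sup>2)"
      by (simp add: h_def rad_def algebra_simps)
    then show ?thesis unfolding rad_swap_sum tent_kernel_def .
  qed
  \<comment> \<open>Adding the transposed integral doubles it, which turns the prefactor 1/(8 pi^2)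
    into 1/(16 pi^2).\<close>
  have "2 * integral\<^sup>L (lborel \<Otimes>\<^sub>M lborel) h
      = integral\<^sup>L (lborel \<Otimes>\<^sub>M lborel) (\<lambda>xy. h xy + (case xy of (x, y) \<Rightarrow> h (y, x)))"
    using h_int lborel_pair.integrable_product_swap[OF h_int] swap by simp
  also have "\<dots> = (\<integral>(x, y). dens x * dens y * tent_kernel R x y \<partial>(lborel \<Otimes>\<^sub>M lborel))"
    by (intro Bochner_Integration.integral_cong) (auto simp: sum)
  finally show "(\<integral>x. tent R x * dens x * D_reg 0 x \<partial>lborel)
      = - 1 / (16 * pi\<^sup>2) * (\<integral>(x, y). dens x * dens y * tent_kernel R x y \<partial>(lborel \<Otimes>\<^sub>M lborel))"
    using eq by (simp add: field_simps)
qed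

section \<open>Removing the cutoff and the upper bound for the mass\<close>

lemma tent_identity:
  assumes R: "R > 0"
  shows "4 * (\<integral>x. tent R x * dens x \<partial>lborel) + (\<integral>x. tent' R x * dens x \<partial>lborel) - p * (\<integral>x. tent R x * pow_dens x \<partial>lborel)
    = 1 / (4 * pi\<^sup>2) * (\<integral>(x, y). dens x * dens y * tent_kernel R x y \<partial>(lborel \<Otimes>\<^sub>M lborel))"
proof -
  have eq: "(4 * tent R x * K_pow p x + tent' R x * K_pow p x - p * tent R x * norm x powr p) * exp (4 * U x)
    + 4 * (tent R x * K_pow p x * exp (4 * U x) * D_reg 0 x)
    = 4 * (tent R x * dens x) + tent' R x * dens x - p * (tent R x * pow_dens x) + 4 * (tent R x * dens x * D_reg 0 x)" for x
    by (simp add: dens_def pow_dens_def algebra_simps)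
  have "4 * (\<integral>x. tent R x * dens x \<partial>lborel) + (\<integral>x. tent' R x * dens x \<partial>lborel) - p * (\<integral>x. tent R x * pow_dens x \<partial>lborel)
      + 4 * (\<integral>x. tent R x * dens x * D_reg 0 x \<partial>lborel) = 0"
    using tent_identity_U[OF R] tent_times_integrable[OF dens_integrable R] tent_times_integrable[OF pow_dens_integrable R]
      tent_D_reg(1)[OF R]
    unfolding eq by simp
  then show ?thesis
    unfolding tent_D_reg(2)[OF R] by simp
qed

text \<open>Each diagonal slice is a null set, so the limiting kernel simply factorises the double
  integral.\<close>

lemma pair_density_integral: "(\<integral>(x, y). dens x * dens y * (if x = y then 0 else 1) \<partial>(lborel \<Otimes>\<^sub>M lborel)) = (integral\<^sup>L lborel dens)\<^sup>2"
proof -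
  have i: "integrable (lborel \<Otimes>\<^sub>M lborel) (\<lambda>(x, y). dens x * dens y * (if x = y then 0 else 1))"
    by (rule Bochner_Integration.integrable_bound[OF integrable_pair_mult[OF dens_integrable dens_integrable]]) auto
  have "(\<integral>y. dens x * dens y * (if x = y then 0 else 1) \<partial>lborel) = dens x * integral\<^sup>L lborel dens" for x
  proof -
    have "(\<integral>y. dens x * dens y * (if x = y then 0 else 1) \<partial>lborel) = (\<integral>y. dens x * dens y \<partial>lborel)"
    proof (rule integral_cong_AE)
      show "AE y in lborel. dens x * dens y * (if x = y then 0 else 1) = dens x * dens y"
        using AE_lborel_neq[of x] by eventually_elim auto
    qed measurable
    then show ?thesis by simp
  qed
  then show ?thesis
    using lborel_pair.integral_fst'[OF i] by (simp add: power2_eq_square)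
qed

text \<open>The cutoff radius is sent to infinity. The cutoff and its radial derivative are bounded
  by 1 and the symmetrised kernel by 2, so integrability of the densities suffices; the derivative
  term tends to 0 without any decay estimate on \<open>U\<close>.\<close>

lemma pohozaev:
  "4 * integral\<^sup>L lborel dens - p * integral\<^sup>L lborel pow_dens = (integral\<^sup>L lborel dens)\<^sup>2 / (4 * pi\<^sup>2)"
proof -
  have t1: "(\<lambda>n. \<integral>x. tent (real (Suc n)) x * h x \<partial>lborel) \<longlonglongrightarrow> integral\<^sup>L lborel h"
    if h: "integrable lborel h" for h :: "real^4 \<Rightarrow> real"
  proof (rule integral_dominated_convergence[OF _ _ integrable_abs[OF h]])
    show "AE x in lborel. (\<lambda>n. tent (real (Suc n)) x * h x) \<longlonglongrightarrow> h x"
      using tendsto_mult_right[OF tent_tendsto] by simp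
    show "AE x in lborel. norm (tent (real (Suc n)) x * h x) \<le> \<bar>h x\<bar>" for n
      using tent_le[of "real (Suc n)"] by (auto simp: abs_mult tent_nonneg intro!: mult_left_le_one_le)
  qed (use h in measurable)
  have t2: "(\<lambda>n. \<integral>x. tent' (real (Suc n)) x * dens x \<partial>lborel) \<longlonglongrightarrow> (\<integral>x. (0::real) \<partial>(lborel :: (real^4) measure))"
  proof (rule integral_dominated_convergence[OF _ _ integrable_abs[OF dens_integrable]])
    show "AE x in lborel. (\<lambda>n. tent' (real (Suc n)) x * dens x) \<longlonglongrightarrow> 0"
      using tendsto_mult_left_zero[OF tent'_tendsto] by simp
    show "AE x in lborel. norm (tent' (real (Suc n)) x * dens x) \<le> \<bar>dens x\<bar>" for n
      using abs_tent'_le[of "real (Suc n)"] by (auto simp: abs_mult intro!: mult_left_le_one_le)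
  qed measurable
  have t3: "(\<lambda>n. \<integral>(x, y). dens x * dens y * tent_kernel (real (Suc n)) x y \<partial>(lborel \<Otimes>\<^sub>M lborel))
      \<longlonglongrightarrow> (\<integral>(x, y). dens x * dens y * (if x = y then 0 else 1) \<partial>(lborel \<Otimes>\<^sub>M lborel))"
  proof (rule integral_dominated_convergence)
    show "integrable (lborel \<Otimes>\<^sub>M lborel) (\<lambda>xy. 2 * \<bar>case xy of (x, y) \<Rightarrow> dens x * dens y\<bar>)"
      by (intro integrable_mult_right integrable_abs integrable_pair_mult dens_integrable)
    show "AE xy in lborel \<Otimes>\<^sub>M lborel. (\<lambda>n. case xy of (x, y) \<Rightarrow> dens x * dens y * tent_kernel (real (Suc n)) x y)
        \<longlonglongrightarrow> (case xy of (x, y) \<Rightarrow> dens x * dens y * (if x = y then 0 else 1))"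
    proof (rule AE_I2, clarify)
      fix x y :: "real^4"
      show "(\<lambda>n. dens x * dens y * tent_kernel (real (Suc n)) x y) \<longlonglongrightarrow> dens x * dens y * (if x = y then 0 else 1)"
        by (intro tendsto_mult_left tent_kernel_tendsto)
    qed
    show "AE xy in lborel \<Otimes>\<^sub>M lborel. norm (case xy of (x, y) \<Rightarrow> dens x * dens y * tent_kernel (real (Suc n)) x y)
        \<le> 2 * \<bar>case xy of (x, y) \<Rightarrow> dens x * dens y\<bar>" for n
    proof (rule AE_I2, clarify)
      fix x y :: "real^4"
      show "norm (dens x * dens y * tent_kernel (real (Suc n)) x y) \<le> 2 * \<bar>dens x * dens y\<bar>"
        using mult_left_mono[OF abs_tent_kernel_le[of "real (Suc n)" x y], of "\<bar>dens x * dens y\<bar>"]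
        by (simp add: abs_mult mult.commute)
    qed
  qed measurable
  have "(\<lambda>n. 4 * (\<integral>x. tent (real (Suc n)) x * dens x \<partial>lborel) + (\<integral>x. tent' (real (Suc n)) x * dens x \<partial>lborel)
      - p * (\<integral>x. tent (real (Suc n)) x * pow_dens x \<partial>lborel)) \<longlonglongrightarrow> 4 * integral\<^sup>L lborel dens + 0 - p * integral\<^sup>L lborel pow_dens"
    using t2 by (intro tendsto_intros t1 dens_integrable pow_dens_integrable) simp
  moreover have "(\<lambda>n. 1 / (4 * pi\<^sup>2) * (\<integral>(x, y). dens x * dens y * tent_kernel (real (Suc n)) x y \<partial>(lborel \<Otimes>\<^sub>M lborel)))
      \<longlonglongrightarrow> 1 / (4 * pi\<^sup>2) * (integral\<^sup>L lborel dens)\<^sup>2"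
    using t3 unfolding pair_density_integral by (intro tendsto_mult_left)
  ultimately show ?thesis
    using LIMSEQ_unique by (fastforce simp: tent_identity simp del: of_nat_Suc)
qed

lemma pow_dens_integral_pos: "0 < integral\<^sup>L lborel pow_dens"
proof -
  have "integral\<^sup>L lborel pow_dens \<noteq> 0"
  proof
    assume "integral\<^sup>L lborel pow_dens = 0"
    then have "AE x in lborel. pow_dens x = 0"
      using integral_nonneg_eq_0_iff_AE[OF pow_dens_integrable] pow_dens_nonneg by simp
    then have "AE x in lborel. (x::real^4) \<in> {0}"
      by eventually_elim (simp add: pow_dens_def)
    then have "emeasure lborel (UNIV - {0::real^4}) = 0"
      by (simp add: AE_iff_measurable[OF _ refl] set_diff_eq)
    then have "emeasure lborel (UNIV :: (real^4) set) = 0"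
      by (subst (asm) emeasure_Diff_null_set) auto
    then show False by simp
  qed
  then show ?thesis
    using integral_nonneg_AE[of pow_dens lborel] pow_dens_nonneg by (auto simp: less_le)
qed

text \<open>Positivity of the last integral in \<open>pohozaev\<close> gives L(16 pi^2 - L) > 0
  strictly, so the endpoint is excluded too.\<close>

lemma mass_less_sphere: "integral\<^sup>L lborel dens < 16 * pi\<^sup>2"
proof -
  let ?L = "integral\<^sup>L lborel dens"
  have "4 * ?L - ?L\<^sup>2 / (4 * pi\<^sup>2) > 0"
    using pohozaev mult_pos_pos[OF p_pos pow_dens_integral_pos] by simp
  then have "?L * (16 * pi\<^sup>2 - ?L) > 0"
    by (simp add: field_simps power2_eq_square)
  then have "0 < ?L \<and> 0 < 16 * pi\<^sup>2 - ?L \<or> ?L < 0 \<and> 16 * pi\<^sup>2 - ?L < 0"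
    unfolding zero_less_mult_iff .
  moreover have "16 * pi\<^sup>2 > 0" by simp
  ultimately show "?L < 16 * pi\<^sup>2"
    by linarith
qed

end

section \<open>Lower bound for the mass\<close>

definition far_ball :: "(real^4) set" where
  "far_ball = ball (2 *\<^sub>R axis 1 1) 1"

lemma far_ball_borel[measurable]: "far_ball \<in> sets borel"
  by (simp add: far_ball_def)

lemma norm_far_ball: "x \<in> far_ball \<Longrightarrow> 1 \<le> norm x \<and> norm x \<le> 3"
proof -
  assume "x \<in> far_ball"
  then have "norm (2 *\<^sub>R axis 1 1 - x) < 1" by (simp add: far_ball_def dist_norm)
  moreover have "norm (2 *\<^sub>R axis 1 (1::real) :: real^4) = 2" by simp
  ultimately show ?thesis
    using norm_triangle_ineq2[of "2 *\<^sub>R axis 1 1" x] norm_triangle_ineq3[of "2 *\<^sub>R axis 1 1" x]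
    by (auto simp: abs_le_iff)
qed

lemma far_ball_finite: "emeasure lborel far_ball < \<infinity>"
  by (simp add: far_ball_def emeasure_lborel_ball_finite[unfolded infinity_ennreal_def])

definition far_vol :: real where
  "far_vol = measure lborel far_ball"

lemma far_vol_pos: "0 < far_vol"
  unfolding far_vol_def far_ball_def by (rule content_ball_pos) simp

lemma far_ball_integrable: "integrable lborel (indicator far_ball :: _ \<Rightarrow> real)"
  using far_ball_finite by (intro integrable_real_indicator) auto

text \<open>Two estimates are merged. log(R/d) <= R/d extracts log R - log(1 + |y|), useful for
  small \<open>y\<close>; 1 + |y| <= 4R + d bounds the kernel when that term is negative. The
  maximum with 0 keeps the better of the two.\<close>

lemma logk_scaled_le:
  assumes R: "1 \<le> R" and x: "norm x \<le> 3" "R *\<^sub>R x \<noteq> y"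
  shows "logk (R *\<^sub>R x) y \<le> 4 * (1 / norm (x - y /\<^sub>R R)) - max 0 (ln R - ln (1 + norm y))"
proof -
  define d where "d = norm (R *\<^sub>R x - y)"
  have d: "d > 0" using x by (simp add: d_def)
  have "R *\<^sub>R x - y = R *\<^sub>R (x - y /\<^sub>R R)" using R by (simp add: algebra_simps)
  then have dR: "d = R * norm (x - y /\<^sub>R R)" using R by (simp add: d_def)
  then have s: "1 / norm (x - y /\<^sub>R R) = R / d" using R by simp
  have k: "logk (R *\<^sub>R x) y = ln (1 + norm y) - ln d" by (simp add: logk_def d_def)
  have "ln (R / d) \<le> R / d - 1" using R d by (intro ln_le_minus_one) auto
  then have "ln R - ln d \<le> R / d" using R d by (simp add: ln_divide_pos)
  moreover have "0 \<le> R / d" using R d by simp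
  ultimately have 1: "logk (R *\<^sub>R x) y \<le> 4 * (R / d) - (ln R - ln (1 + norm y))"
    unfolding k by linarith
  have "1 + norm y \<le> 4 * R + d"
  proof -
    have "norm y \<le> norm (R *\<^sub>R x) + d"
      unfolding d_def using norm_triangle_ineq2[of y "R *\<^sub>R x"] by (simp add: norm_minus_commute)
    moreover have "norm (R *\<^sub>R x) \<le> R * 3" using R x by simp
    ultimately show ?thesis using R by linarith
  qed
  then have "(1 + norm y) / d \<le> (4 * R + d) / d" using d by (intro divide_right_mono) auto
  also have "\<dots> = 4 * (R / d) + 1" using d by (simp add: add_divide_distrib)
  finally have "(1 + norm y) / d - 1 \<le> 4 * (R / d)" by simp
  moreover have "ln ((1 + norm y) / d) \<le> (1 + norm y) / d - 1"
    using d by (intro ln_le_minus_one divide_pos_pos) (auto intro: add_pos_nonneg)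
  moreover have "ln ((1 + norm y) / d) = ln (1 + norm y) - ln d"
    using d by (subst ln_divide_pos) (auto intro: add_pos_nonneg)
  ultimately have 2: "logk (R *\<^sub>R x) y \<le> 4 * (R / d)"
    unfolding k by linarith
  show ?thesis unfolding s using 1 2 by simp
qed

lemma integral_far_ball_inverse_norm:
  "integrable lborel (\<lambda>x. indicator far_ball x * (1 / norm (x - z)))"
  "(\<integral>x. indicator far_ball x * (1 / norm (x - z)) \<partial>lborel) \<le> far_vol + ball_pot"
proof -
  have eq: "ennreal (indicator far_ball x * (1 / norm (x - z))) = indicator far_ball x * ennreal (1 / norm (x - z))" for x
    by (simp add: indicator_def)
  have le: "(\<integral>\<^sup>+x. ennreal (indicator far_ball x * (1 / norm (x - z))) \<partial>lborel) \<le> ennreal (far_vol + ball_pot)"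
    unfolding eq far_vol_def by (intro nn_integral_inverse_norm_le far_ball_finite) simp
  show i: "integrable lborel (\<lambda>x. indicator far_ball x * (1 / norm (x - z)))"
    using le by (intro integrableI_nonneg) (auto simp: less_top[symmetric] top_unique simp del: times_divide_eq_right)
  show "(\<integral>x. indicator far_ball x * (1 / norm (x - z)) \<partial>lborel) \<le> far_vol + ball_pot"
    using le i far_vol_pos ball_pot_nonneg by (subst (asm) nn_integral_eq_integral) (auto simp del: ennreal_plus)
qed

definition scaled_ball :: "real \<Rightarrow> (real^4) set" where
  "scaled_ball R = ball ((2 * R) *\<^sub>R axis 1 1) R"

lemma scaled_ball_borel[measurable]: "scaled_ball R \<in> sets borel"
  by (simp add: scaled_ball_def)

lemma scaleR_in_scaled_ball_iff:
  assumes "R > 0"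
  shows "R *\<^sub>R x \<in> scaled_ball R \<longleftrightarrow> x \<in> far_ball"
proof -
  have "(2 * R) *\<^sub>R axis 1 1 - R *\<^sub>R x = R *\<^sub>R (2 *\<^sub>R axis 1 1 - x)" by (simp add: algebra_simps)
  then have "norm ((2 * R) *\<^sub>R axis 1 1 - R *\<^sub>R x) = R * norm (2 *\<^sub>R axis 1 1 - x)"
    using assms by simp
  then show ?thesis using assms by (simp add: scaled_ball_def far_ball_def dist_norm)
qed

lemma norm_scaled_ball:
  assumes "R > 0" "z \<in> scaled_ball R"
  shows "R \<le> norm z \<and> norm z \<le> 3 * R"
proof -
  have z: "z = R *\<^sub>R (z /\<^sub>R R)" using assms by simp
  then have "z /\<^sub>R R \<in> far_ball" using assms scaleR_in_scaled_ball_iff[of R "z /\<^sub>R R"] by simp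
  then have n: "1 \<le> norm (z /\<^sub>R R) \<and> norm (z /\<^sub>R R) \<le> 3" by (rule norm_far_ball)
  have "norm (z /\<^sub>R R) = norm z / R" using assms by (simp add: divide_inverse)
  then show ?thesis using n assms by (simp add: field_simps)
qed

lemma scaled_ball_integrable: "integrable lborel (indicator (scaled_ball R) :: _ \<Rightarrow> real)"
  unfolding scaled_ball_def using emeasure_lborel_ball_finite[of "(2 * R) *\<^sub>R axis 1 (1::real) :: real^4" R]
  by (intro integrable_real_indicator) auto

lemma integral_scaled_ball:
  assumes "R > 0"
  shows "(\<integral>z. indicator (scaled_ball R) z \<partial>lborel) = R ^ 4 * far_vol"
proof -
  have "(\<integral>z. indicator (scaled_ball R) z \<partial>lborel) = R ^ 4 * (\<integral>x. indicator (scaled_ball R) (R *\<^sub>R x) \<partial>lborel)"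
    using integral_lborel_scale[OF scaled_ball_integrable, of R R] assms by simp
  also have "(\<lambda>x. indicator (scaled_ball R) (R *\<^sub>R x) :: real) = indicator far_ball"
    using scaleR_in_scaled_ball_iff[OF assms] by (auto simp: indicator_def)
  finally show ?thesis by (simp add: far_vol_def)
qed

lemma logk_scaled_ball_integrable:
  assumes R: "R > 0"
  shows "integrable lborel (\<lambda>z. indicator (scaled_ball R) z * logk z y)"
proof (rule Bochner_Integration.integrable_bound)
  let ?g = "\<lambda>z. ln (1 + 3 * R) * indicator (scaled_ball R) z
      + (1 + 3 * R) * (indicator (scaled_ball R) z + indicator (ball y 1) z * (1 / norm (y - z)))"
  show "integrable lborel ?g"
    by (intro Bochner_Integration.integrable_add integrable_mult_right scaled_ball_integrable
        integrable_inverse_norm_ball)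
  show "AE z in lborel. norm (indicator (scaled_ball R) z * logk z y) \<le> norm (?g z)"
  proof (rule AE_I2)
    fix z :: "real^4"
    have "\<bar>logk z y\<bar> \<le> ?g z" if z: "z \<in> scaled_ball R"
    proof -
      have n: "norm z \<le> 3 * R" using norm_scaled_ball[OF R z] by simp
      have "1 / norm (z - y) \<le> indicator (scaled_ball R) z + indicator (ball y 1) z * (1 / norm (y - z))"
        using z by (cases "z \<in> ball y 1") (auto simp: dist_norm norm_minus_commute divide_le_eq_1)
      then have "(1 + 3 * R) * (1 / norm (z - y))
          \<le> (1 + 3 * R) * (indicator (scaled_ball R) z + indicator (ball y 1) z * (1 / norm (y - z)))"
        using R by (intro mult_left_mono) auto
      moreover have "(1 + norm z) / norm (z - y) \<le> (1 + 3 * R) / norm (z - y)"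
        using n by (intro divide_right_mono) auto
      moreover have "ln (1 + norm z) \<le> ln (1 + 3 * R)"
        using n R by (intro ln_mono) (auto intro: add_pos_nonneg)
      ultimately show ?thesis
        using abs_logk_le[of z y] z by simp
    qed
    then show "norm (indicator (scaled_ball R) z * logk z y) \<le> norm (?g z)"
      by (cases "z \<in> scaled_ball R") (auto intro: order.trans[OF _ abs_ge_self] simp del: times_divide_eq_right mult_1_right)
  qed
qed measurable

text \<open>Bounds the average of 4/|x - z| over \<open>far_ball\<close>, uniformly in
  \<open>z\<close>.\<close>

definition avg_const :: real where
  "avg_const = 4 * (far_vol + ball_pot) / far_vol"

lemma logk_average_le:
  assumes R: "1 \<le> R"
  shows "(\<integral>z. indicator (scaled_ball R) z * logk z y \<partial>lborel)
    \<le> R ^ 4 * far_vol * (avg_const - max 0 (ln R - ln (1 + norm y)))"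
proof -
  have R0: "R > 0" using R by simp
  let ?m = "max 0 (ln R - ln (1 + norm y))"
  have ind: "indicator (scaled_ball R) (R *\<^sub>R x) = (indicator far_ball x :: real)" for x
    using scaleR_in_scaled_ball_iff[OF R0] by (auto simp: indicator_def)
  have i: "integrable lborel (\<lambda>x. indicator far_ball x * logk (R *\<^sub>R x) y)"
    using integrable_lborel_scale[OF logk_scaled_ball_integrable[OF R0, of y], of R] R0 by (simp add: ind)
  have i2: "integrable lborel (\<lambda>x. 4 * (indicator far_ball x * (1 / norm (x - y /\<^sub>R R))) - ?m * indicator far_ball x)"
    by (intro Bochner_Integration.integrable_diff integrable_mult_right integral_far_ball_inverse_norm
        far_ball_integrable)
  have "(\<integral>x. indicator far_ball x * logk (R *\<^sub>R x) y \<partial>lborel)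
      \<le> (\<integral>x. 4 * (indicator far_ball x * (1 / norm (x - y /\<^sub>R R))) - ?m * indicator far_ball x \<partial>lborel)"
  proof (rule integral_mono_AE[OF i i2])
    show "AE x in lborel. indicator far_ball x * logk (R *\<^sub>R x) y
        \<le> 4 * (indicator far_ball x * (1 / norm (x - y /\<^sub>R R))) - ?m * indicator far_ball x"
      using AE_lborel_neq[of "y /\<^sub>R R"]
    proof eventually_elim
      case (elim x)
      then have "R *\<^sub>R x \<noteq> y" using R0 by auto
      then show ?case
        using logk_scaled_le[OF R, of x y] norm_far_ball[of x] by (cases "x \<in> far_ball") auto
    qed
  qed
  also have "\<dots> = 4 * (\<integral>x. indicator far_ball x * (1 / norm (x - y /\<^sub>R R)) \<partial>lborel) - ?m * far_vol"
    by (subst Bochner_Integration.integral_diff)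
      (auto intro!: integrable_mult_right integral_far_ball_inverse_norm far_ball_integrable
        simp: far_vol_def simp del: times_divide_eq_right mult_1_right)
  also have "\<dots> \<le> 4 * (far_vol + ball_pot) - ?m * far_vol"
    using integral_far_ball_inverse_norm(2)[of "y /\<^sub>R R"] by simp
  also have "\<dots> = far_vol * (avg_const - ?m)"
    using far_vol_pos by (simp add: avg_const_def right_diff_distrib)
  finally have "R ^ 4 * (\<integral>x. indicator far_ball x * logk (R *\<^sub>R x) y \<partial>lborel) \<le> R ^ 4 * (far_vol * (avg_const - ?m))"
    using R0 by (intro mult_left_mono) auto
  moreover have "(\<integral>z. indicator (scaled_ball R) z * logk z y \<partial>lborel)
      = R ^ 4 * (\<integral>x. indicator far_ball x * logk (R *\<^sub>R x) y \<partial>lborel)"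
    using integral_lborel_scale[OF logk_scaled_ball_integrable[OF R0, of y], of R] R0 by (simp add: ind)
  ultimately show ?thesis by (simp add: mult.assoc)
qed

text \<open>On the ball 1 + |z| <= 1 + 3R <= 4R, so \<open>logk_ge\<close> gives a bound independent
  of \<open>y\<close>.\<close>

lemma logk_average_ge:
  assumes R: "1 \<le> R"
  shows "- (R ^ 4 * far_vol * (ln R + ln 4)) \<le> (\<integral>z. indicator (scaled_ball R) z * logk z y \<partial>lborel)"
proof -
  have R0: "R > 0" using R by simp
  have "(\<integral>z. - (ln R + ln 4) * indicator (scaled_ball R) z \<partial>lborel)
      \<le> (\<integral>z. indicator (scaled_ball R) z * logk z y \<partial>lborel)"
  proof (intro integral_mono integrable_mult_right scaled_ball_integrable logk_scaled_ball_integrable R0)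
    fix z :: "real^4"
    have "- (ln R + ln 4) \<le> logk z y" if "z \<in> scaled_ball R"
    proof -
      have "ln (1 + norm z) \<le> ln (R * 4)"
        using norm_scaled_ball[OF R0 that] R by (intro ln_mono) (auto intro: add_pos_nonneg)
      also have "\<dots> = ln R + ln 4" using R0 by (simp add: ln_mult_pos)
      finally show ?thesis using logk_ge[of z y] by linarith
    qed
    then show "- (ln R + ln 4) * indicator (scaled_ball R) z \<le> indicator (scaled_ball R) z * logk z y"
      by (simp add: indicator_def)
  qed
  then have "- (ln R + ln 4) * (R ^ 4 * far_vol) \<le> (\<integral>z. indicator (scaled_ball R) z * logk z y \<partial>lborel)"
    unfolding integral_mult_right_zero integral_scaled_ball[OF R0] .
  then show ?thesis by (simp add: algebra_simps)
qed

text \<open>The logarithmic gain in \<open>logk_average_le\<close> for R = e^n. Divided by n it lies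
  between 0 and 1 and tends to 1 pointwise.\<close>

definition trunc :: "nat \<Rightarrow> real^4 \<Rightarrow> real" where
  "trunc n y = max 0 (real n - ln (1 + norm y))"

lemma trunc_measurable[measurable]: "trunc n \<in> borel_measurable borel"
  unfolding trunc_def by measurable

lemma abs_trunc_le: "\<bar>trunc n y\<bar> \<le> real n"
  using ln_ge_zero[of "1 + norm y"] by (simp add: trunc_def)

context normal_potential
begin

lemma logk_pair_integrable:
  assumes R: "R > 0"
  shows "integrable (lborel \<Otimes>\<^sub>M lborel) (\<lambda>(z, y). indicator (scaled_ball R) z * (logk z y * dens y))"
proof (rule Bochner_Integration.integrable_bound)
  have 1: "integrable (lborel \<Otimes>\<^sub>M lborel) (\<lambda>(z, y). indicator (scaled_ball R) z * (ln (1 + 3 * R) * \<bar>dens y\<bar>))"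
    by (intro integrable_pair_mult scaled_ball_integrable integrable_mult_right integrable_abs dens_integrable)
  have 2: "integrable (lborel \<Otimes>\<^sub>M lborel)
      (\<lambda>(z, y). indicator (scaled_ball R) z * ((1 + 3 * R) * \<bar>dens y\<bar> / norm (z - y)))"
    by (intro integrable_pair_inverse_norm integrable_mult_right integrable_abs dens_integrable)
      (use emeasure_lborel_ball_finite in \<open>auto simp: scaled_ball_def\<close>)
  show "integrable (lborel \<Otimes>\<^sub>M lborel) (\<lambda>zy. (case zy of (z, y) \<Rightarrow> indicator (scaled_ball R) z * (ln (1 + 3 * R) * \<bar>dens y\<bar>))
      + (case zy of (z, y) \<Rightarrow> indicator (scaled_ball R) z * ((1 + 3 * R) * \<bar>dens y\<bar> / norm (z - y))))"
    by (intro Bochner_Integration.integrable_add 1 2)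
  show "AE zy in lborel \<Otimes>\<^sub>M lborel. norm (case zy of (z, y) \<Rightarrow> indicator (scaled_ball R) z * (logk z y * dens y))
      \<le> norm ((case zy of (z, y) \<Rightarrow> indicator (scaled_ball R) z * (ln (1 + 3 * R) * \<bar>dens y\<bar>))
      + (case zy of (z, y) \<Rightarrow> indicator (scaled_ball R) z * ((1 + 3 * R) * \<bar>dens y\<bar> / norm (z - y))))"
  proof (rule AE_I2, clarify)
    fix z y :: "real^4"
    have "\<bar>logk z y * dens y\<bar> \<le> ln (1 + 3 * R) * \<bar>dens y\<bar> + (1 + 3 * R) * \<bar>dens y\<bar> / norm (z - y)"
      if z: "z \<in> scaled_ball R"
    proof -
      have n: "norm z \<le> 3 * R" using norm_scaled_ball[OF R z] by simp
      have "\<bar>logk z y\<bar> \<le> ln (1 + norm z) + (1 + norm z) / norm (z - y)"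
        by (rule abs_logk_le)
      also have "\<dots> \<le> ln (1 + 3 * R) + (1 + 3 * R) / norm (z - y)"
        using n R by (intro add_mono ln_mono divide_right_mono) (auto intro: add_pos_nonneg)
      finally have "\<bar>logk z y\<bar> * \<bar>dens y\<bar> \<le> (ln (1 + 3 * R) + (1 + 3 * R) / norm (z - y)) * \<bar>dens y\<bar>"
        by (rule mult_right_mono) simp
      then show ?thesis by (simp add: abs_mult distrib_right)
    qed
    then show "norm (indicator (scaled_ball R) z * (logk z y * dens y))
      \<le> norm (indicator (scaled_ball R) z * (ln (1 + 3 * R) * \<bar>dens y\<bar>)
        + indicator (scaled_ball R) z * ((1 + 3 * R) * \<bar>dens y\<bar> / norm (z - y)))"
      by (cases "z \<in> scaled_ball R") (auto intro: order.trans[OF _ abs_ge_self])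
  qed
qed measurable

lemma trunc_dens_integrable: "integrable lborel (\<lambda>y. trunc n y * dens y)"
proof (rule Bochner_Integration.integrable_bound)
  show "integrable lborel (\<lambda>y. real n * \<bar>dens y\<bar>)"
    by (intro integrable_mult_right integrable_abs dens_integrable)
  show "AE y in lborel. norm (trunc n y * dens y) \<le> norm (real n * \<bar>dens y\<bar>)"
    using mult_right_mono[OF abs_trunc_le] by (intro AE_I2) (simp add: abs_mult)
qed measurable

text \<open>Dominated convergence identifies the leading coefficient of the average with the total
  mass, again without decay of the density.\<close>

lemma trunc_dens_tendsto:
  "(\<lambda>n. (\<integral>y. trunc (Suc n) y * dens y \<partial>lborel) / real (Suc n)) \<longlonglongrightarrow> integral\<^sup>L lborel dens"
proof -
  have "(\<lambda>n. \<integral>y. trunc (Suc n) y * dens y / real (Suc n) \<partial>lborel) \<longlonglongrightarrow> integral\<^sup>L lborel dens"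
  proof (rule integral_dominated_convergence[OF _ _ integrable_abs[OF dens_integrable]])
    show "AE y in lborel. (\<lambda>n. trunc (Suc n) y * dens y / real (Suc n)) \<longlonglongrightarrow> dens y"
    proof (rule AE_I2)
      fix y
      have "trunc (Suc n) y / real (Suc n) = max 0 (1 - ln (1 + norm y) * inverse (real (Suc n)))" for n
      proof -
        have "trunc (Suc n) y / real (Suc n) = max (0 / real (Suc n)) ((real (Suc n) - ln (1 + norm y)) / real (Suc n))"
          unfolding trunc_def by (subst max_divide_distrib_right) (simp del: of_nat_Suc)
        also have "(real (Suc n) - ln (1 + norm y)) / real (Suc n) = 1 - ln (1 + norm y) * inverse (real (Suc n))"
          by (simp add: field_simps del: of_nat_Suc)
        finally show ?thesis by simp
      qed
      moreover have "(\<lambda>n. max 0 (1 - ln (1 + norm y) * inverse (real (Suc n)))) \<longlonglongrightarrow> max 0 (1 - ln (1 + norm y) * 0)"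
        by (intro tendsto_intros LIMSEQ_inverse_real_of_nat)
      ultimately have "(\<lambda>n. trunc (Suc n) y / real (Suc n)) \<longlonglongrightarrow> 1" by simp
      from tendsto_mult_right[OF this, of "dens y"]
      show "(\<lambda>n. trunc (Suc n) y * dens y / real (Suc n)) \<longlonglongrightarrow> dens y" by simp
    qed
    show "AE y in lborel. norm (trunc (Suc n) y * dens y / real (Suc n)) \<le> \<bar>dens y\<bar>" for n
      using mult_right_mono[OF abs_trunc_le[of "Suc n"], of "\<bar>dens _\<bar>"]
      by (intro AE_I2) (simp add: abs_mult pos_divide_le_eq mult.commute del: of_nat_Suc)
  qed measurable
  then show ?thesis by simp
qed

text \<open>The sign of \<open>dens\<close> decides which bound on the averaged kernel is relevant:
  the lower one inside the unit ball, the upper one outside. Inside, replacing n by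
  \<open>trunc n y\<close> costs at most ln 2, which with ln 4 yields the ln 8.\<close>

lemma logk_average_dens_ge:
  assumes R: "R = exp (real n)" 
  shows "- (R ^ 4 * far_vol) * (trunc n y * dens y + (avg_const + ln 8) * \<bar>dens y\<bar>)
    \<le> (\<integral>z. indicator (scaled_ball R) z * logk z y \<partial>lborel) * dens y"
proof -
  have R1: "1 \<le> R" and lnR: "ln R = real n" using R by auto
  define b where "b = (\<integral>z. indicator (scaled_ball R) z * logk z y \<partial>lborel)"
  define Q where "Q = R ^ 4 * far_vol"
  have Q: "Q > 0" using R1 far_vol_pos by (simp add: Q_def)
  have ac: "avg_const \<ge> 0" using far_vol_pos ball_pot_nonneg by (simp add: avg_const_def)
  have up: "b \<le> Q * (avg_const - trunc n y)"
    using logk_average_le[OF R1, of y] by (simp add: b_def Q_def trunc_def lnR)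
  have low: "- (Q * (real n + ln 4)) \<le> b"
    using logk_average_ge[OF R1, of y] by (simp add: b_def Q_def lnR)
  have "- Q * (trunc n y * dens y + (avg_const + ln 8) * \<bar>dens y\<bar>) \<le> b * dens y"
  proof (cases "norm y < 1")
    case True
    then have fy: "dens y \<ge> 0" using dens_nonneg by simp
    have "ln (1 + norm y) \<le> ln 2" using True by (intro ln_mono) (auto intro: add_pos_nonneg)
    then have "real n + ln 4 \<le> trunc n y + (ln 2 + ln 4)" unfolding trunc_def by linarith
    also have "ln 2 + ln 4 = ln (8::real)" by (simp flip: ln_mult_pos)
    finally have "real n + ln 4 \<le> trunc n y + (avg_const + ln 8)" using ac by linarith
    then have "Q * (real n + ln 4) \<le> Q * (trunc n y + (avg_const + ln 8))"
      using Q by (intro mult_left_mono) auto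
    then have "- Q * (trunc n y + (avg_const + ln 8)) \<le> b"
      using low unfolding mult_minus_left by linarith
    then have "- Q * (trunc n y + (avg_const + ln 8)) * dens y \<le> b * dens y"
      using fy by (rule mult_right_mono)
    then show ?thesis using fy by (simp add: algebra_simps)
  next
    case False
    then have fy: "dens y \<le> 0" using dens_nonpos by simp
    have "avg_const - trunc n y \<le> (avg_const + ln 8) - trunc n y" by simp
    then have "Q * (avg_const - trunc n y) \<le> Q * ((avg_const + ln 8) - trunc n y)"
      using Q by (intro mult_left_mono) auto
    then have "b \<le> Q * ((avg_const + ln 8) - trunc n y)" using up by linarith
    then have "Q * ((avg_const + ln 8) - trunc n y) * dens y \<le> b * dens y"
      using fy by (rule mult_right_mono_neg)
    then show ?thesis using fy by (simp add: algebra_simps)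
  qed
  then show ?thesis by (simp add: b_def Q_def)
qed

text \<open>Fubini moves the average over the ball from \<open>U\<close> onto the kernel.\<close>

lemma indicator_U_integrable:
  assumes R: "R > 0"
  shows "integrable lborel (\<lambda>z. indicator (scaled_ball R) z * U z)"
    and "(\<integral>z. indicator (scaled_ball R) z * U z \<partial>lborel) = 1 / (8 * pi\<^sup>2) *
      (\<integral>y. (\<integral>z. indicator (scaled_ball R) z * logk z y \<partial>lborel) * dens y \<partial>lborel) + c * (R ^ 4 * far_vol)"
    and "integrable lborel (\<lambda>y. (\<integral>z. indicator (scaled_ball R) z * logk z y \<partial>lborel) * dens y)"
proof -
  note pair = logk_pair_integrable[OF R]
  let ?S = "indicator (scaled_ball R) :: real^4 \<Rightarrow> real"
  have Ueq: "?S z * U z = 1 / (8 * pi\<^sup>2) * (\<integral>y. ?S z * (logk z y * dens y) \<partial>lborel) + c * ?S z" for z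
  proof -
    define I where "I = (\<integral>y. logk z y * dens y \<partial>lborel)"
    have "U z = 1 / (8 * pi\<^sup>2) * I + c" using U_eq_dens[of z] by (simp add: I_def)
    then show ?thesis
      unfolding integral_mult_right_zero I_def[symmetric] by (simp add: algebra_simps)
  qed
  have i1: "integrable lborel (\<lambda>z. \<integral>y. ?S z * (logk z y * dens y) \<partial>lborel)"
    by (rule lborel_pair.integrable_fst[OF pair])
  show "integrable lborel (\<lambda>z. ?S z * U z)"
    unfolding Ueq by (intro Bochner_Integration.integrable_add integrable_mult_right i1 scaled_ball_integrable)
  have sw: "(\<integral>z. ?S z * (logk z y * dens y) \<partial>lborel) = (\<integral>z. ?S z * logk z y \<partial>lborel) * dens y" for y
    by (simp add: mult.assoc[symmetric])
  show "integrable lborel (\<lambda>y. (\<integral>z. ?S z * logk z y \<partial>lborel) * dens y)"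
    using lborel_pair.integrable_snd[OF pair] unfolding sw .
  have "(\<integral>z. ?S z * U z \<partial>lborel)
      = 1 / (8 * pi\<^sup>2) * (\<integral>z. (\<integral>y. ?S z * (logk z y * dens y) \<partial>lborel) \<partial>lborel) + c * (\<integral>z. ?S z \<partial>lborel)"
    unfolding Ueq
    by (subst Bochner_Integration.integral_add[OF integrable_mult_right[OF i1]
          integrable_mult_right[OF scaled_ball_integrable]])
      (simp only: integral_mult_right_zero)
  also have "(\<integral>z. (\<integral>y. ?S z * (logk z y * dens y) \<partial>lborel) \<partial>lborel)
      = (\<integral>y. (\<integral>z. ?S z * (logk z y * dens y) \<partial>lborel) \<partial>lborel)"
    using lborel_pair.integral_fst[OF pair] lborel_pair.integral_snd[OF pair] by simp
  finally show "(\<integral>z. ?S z * U z \<partial>lborel) = 1 / (8 * pi\<^sup>2) *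
      (\<integral>y. (\<integral>z. ?S z * logk z y \<partial>lborel) * dens y \<partial>lborel) + c * (R ^ 4 * far_vol)"
    unfolding sw integral_scaled_ball[OF R] .
qed

text \<open>Jensen's inequality on the ball of radius \<open>R = e\<^sup>n\<close> around \<open>2 R e\<^sub>1\<close>, after taking logarithms.\<close>

lemma log_mass_bound:
  "(4 + p) * real n + ln far_vol + 4 * c
    - 1 / (2 * pi\<^sup>2) * ((\<integral>y. trunc n y * dens y \<partial>lborel) + (avg_const + ln 8) * abs_mass)
    \<le> ln (integral\<^sup>L lborel pow_dens)"
proof -
  define R where "R = exp (real n)"
  have R: "R > 0" "R \<ge> 1" by (auto simp: R_def)
  define Q where "Q = R ^ 4 * far_vol"
  have Q: "Q > 0" using R far_vol_pos by (simp add: Q_def)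
  let ?S = "indicator (scaled_ball R) :: real^4 \<Rightarrow> real"
  \<comment> \<open>The uniform probability density on the ball, so \<open>exp_weighted_le\<close>
    has no missing mass.\<close>
  define g where "g = (\<lambda>z. ?S z / Q)"
  define T where "T = (\<integral>y. trunc n y * dens y \<partial>lborel) + (avg_const + ln 8) * abs_mass"
  define m where "m = (\<integral>z. g z * (4 * U z) \<partial>lborel)"
  have g_nn: "g z \<ge> 0" for z using Q by (simp add: g_def)
  have [measurable]: "g \<in> borel_measurable borel" unfolding g_def by measurable
  have g_int: "integrable lborel g" 
    unfolding g_def using scaled_ball_integrable[of R] by simp
  have g1: "integral\<^sup>L lborel g = 1"
    unfolding g_def integral_divide_zero integral_scaled_ball[OF R(1)] Q_def[symmetric] using Q by simp
  have gU: "g z * (4 * U z) = 4 / Q * (?S z * U z)" for z by (simp add: g_def)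
  have gU_int: "integrable lborel (\<lambda>z. g z * (4 * U z))"
    unfolding gU by (intro integrable_mult_right indicator_U_integrable R)
  have gE_le: "g z * exp (4 * U z) \<le> 1 / Q * R powr (- p) * pow_dens z" for z
  proof (cases "z \<in> scaled_ball R")
    case False
    then show ?thesis using Q pow_dens_nonneg[of z] by (simp add: g_def)
  next
    case True
    \<comment> \<open>The ball lies in |z| >= R, so the weight |z|^p can be inserted at the cost of
      R^(-p). Together with the volume R^4 this produces the exponent 4 + p.\<close>
    have "R powr p \<le> norm z powr p"
      using norm_scaled_ball[OF R(1) True] R p_pos by (intro powr_mono2) auto
    then have "R powr p * exp (4 * U z) \<le> pow_dens z"
      unfolding pow_dens_def by (intro mult_right_mono) auto
    then have "R powr (- p) * (R powr p * exp (4 * U z)) \<le> R powr (- p) * pow_dens z"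
      by (intro mult_left_mono) auto
    also have "R powr (- p) * (R powr p * exp (4 * U z)) = exp (4 * U z)"
      using R by (simp add: powr_minus field_simps)
    finally have "1 / Q * exp (4 * U z) \<le> 1 / Q * (R powr (- p) * pow_dens z)"
      using Q by (intro mult_left_mono) auto
    then show ?thesis using True by (simp add: g_def)
  qed
  have P_int': "integrable lborel (\<lambda>z. 1 / Q * R powr (- p) * pow_dens z)"
    by (intro integrable_mult_right pow_dens_integrable)
  have gE_int: "integrable lborel (\<lambda>z. g z * exp (4 * U z))"
  proof (rule Bochner_Integration.integrable_bound[OF P_int'])
    show "AE z in lborel. norm (g z * exp (4 * U z)) \<le> norm (1 / Q * R powr (- p) * pow_dens z)"
      using order.trans[OF gE_le abs_ge_self] g_nn by (intro AE_I2) (simp add: abs_mult)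
  qed measurable
  have "exp m \<le> 1 - integral\<^sup>L lborel g + (\<integral>z. g z * exp (4 * U z) \<partial>lborel)"
    unfolding m_def by (rule exp_weighted_le[OF g_int gU_int gE_int g_nn]) (simp add: g1)
  also have "\<dots> \<le> (\<integral>z. 1 / Q * R powr (- p) * pow_dens z \<partial>lborel)"
    using integral_mono[OF gE_int P_int' gE_le] g1 by simp
  also have "\<dots> = 1 / Q * R powr (- p) * integral\<^sup>L lborel pow_dens"
    by (rule integral_mult_right_zero)
  finally have "ln (exp m) \<le> ln (1 / Q * R powr (- p) * integral\<^sup>L lborel pow_dens)"
    by (intro ln_mono) auto
  also have "\<dots> = ln (1 / Q) + ln (R powr (- p)) + ln (integral\<^sup>L lborel pow_dens)"
  proof -
    have lm: "ln (a * b * i) = ln a + ln b + ln i" if "a > 0" "b > 0" "i > 0" for a b i :: real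
      using that by (simp add: ln_mult_pos)
    show ?thesis by (rule lm) (use Q R pow_dens_integral_pos in auto)
  qed
  also have "ln (1 / Q) = - (4 * real n + ln far_vol)"
    using R far_vol_pos by (simp add: Q_def ln_divide_pos ln_mult_pos ln_realpow) (simp add: R_def)
  also have "ln (R powr (- p)) = - p * real n"
    using R by (simp add: ln_powr) (simp add: R_def)
  finally have 1: "m \<le> - (4 * real n + ln far_vol) + - p * real n + ln (integral\<^sup>L lborel pow_dens)"
    by simp
  have "(\<integral>y. - Q * (trunc n y * dens y + (avg_const + ln 8) * \<bar>dens y\<bar>) \<partial>lborel)
      \<le> (\<integral>y. (\<integral>z. ?S z * logk z y \<partial>lborel) * dens y \<partial>lborel)"
    unfolding Q_def
    by (intro integral_mono indicator_U_integrable(3) R integrable_mult_right Bochner_Integration.integrable_add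
        trunc_dens_integrable integrable_abs dens_integrable logk_average_dens_ge R_def)
  also have "(\<integral>y. - Q * (trunc n y * dens y + (avg_const + ln 8) * \<bar>dens y\<bar>) \<partial>lborel) = - Q * T"
    unfolding integral_mult_right_zero T_def abs_mass_def
    by (subst Bochner_Integration.integral_add)
      (auto intro!: trunc_dens_integrable integrable_mult_right integrable_abs dens_integrable)
  finally have "4 / Q * (1 / (8 * pi\<^sup>2) * (- Q * T) + c * Q)
      \<le> 4 / Q * (\<integral>z. ?S z * U z \<partial>lborel)"
    unfolding indicator_U_integrable(2)[OF R(1)] Q_def[symmetric] using Q
    by (intro mult_left_mono add_right_mono) auto
  also have "\<dots> = m"
    unfolding m_def gU by (rule integral_mult_right_zero[symmetric])
  also have "4 / Q * (1 / (8 * pi\<^sup>2) * (- Q * T) + c * Q) = 4 * c - 1 / (2 * pi\<^sup>2) * T"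
    using Q by (simp add: field_simps)
  finally have 2: "4 * c - 1 / (2 * pi\<^sup>2) * T \<le> m" .
  show ?thesis using 1 2 by (simp add: T_def algebra_simps)
qed

text \<open>Divides \<open>log_mass_bound\<close> by n and lets n grow: the terms collected in
  \<open>B\<close> vanish, leaving 4 + p <= mass/(2 pi^2).\<close>

lemma mass_ge_star: "(4 + p) * 2 * pi\<^sup>2 \<le> integral\<^sup>L lborel dens"
proof -
  define B where "B = ln far_vol + 4 * c - 1 / (2 * pi\<^sup>2) * ((avg_const + ln 8) * abs_mass) - ln (integral\<^sup>L lborel pow_dens)"
  have le: "(4 + p) + B * inverse (real (Suc n))
      - 1 / (2 * pi\<^sup>2) * ((\<integral>y. trunc (Suc n) y * dens y \<partial>lborel) / real (Suc n)) \<le> 0" for n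
  proof -
    define N where "N = real (Suc n)"
    have N: "N > 0" by (simp add: N_def)
    define I where "I = (\<integral>y. trunc (Suc n) y * dens y \<partial>lborel)"
    have "(4 + p) * N + B - 1 / (2 * pi\<^sup>2) * I \<le> 0"
      using log_mass_bound[of "Suc n"] unfolding B_def N_def[symmetric] I_def[symmetric]
      by (simp add: algebra_simps)
    then have "((4 + p) * N + B - 1 / (2 * pi\<^sup>2) * I) * inverse N \<le> 0"
      using N by (intro mult_nonpos_nonneg) auto
    moreover have "((4 + p) * N + B - 1 / (2 * pi\<^sup>2) * I) * inverse N
        = (4 + p) + B * inverse N - 1 / (2 * pi\<^sup>2) * (I / N)"
      using N by (simp add: field_simps)
    ultimately show ?thesis by (simp add: N_def I_def)
  qed
  have "(\<lambda>n. (4 + p) + B * inverse (real (Suc n))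
      - 1 / (2 * pi\<^sup>2) * ((\<integral>y. trunc (Suc n) y * dens y \<partial>lborel) / real (Suc n)))
      \<longlonglongrightarrow> (4 + p) + B * 0 - 1 / (2 * pi\<^sup>2) * integral\<^sup>L lborel dens"
    by (intro tendsto_intros trunc_dens_tendsto LIMSEQ_inverse_real_of_nat)
  then have "(4 + p) + B * 0 - 1 / (2 * pi\<^sup>2) * integral\<^sup>L lborel dens \<le> 0"
    by (rule LIMSEQ_le_const2) (use le in blast)
  then show ?thesis by (simp add: field_simps)
qed

end

section \<open>Normal solutions\<close>

text \<open>Replaces the density by a Borel function \<open>h\<close>, and the kernel by
  \<open>logk\<close>; the discrepancy \<open>q\<close> depends on \<open>y\<close> alone and its
  integral is absorbed into the constant. The resulting integral defines \<open>U\<close>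
  everywhere, and \<open>U\<close> agrees with \<open>u\<close> almost everywhere.\<close>

lemma normal_potential_of_normal_solution:
  fixes u :: "real^4 \<Rightarrow> real"
  assumes p: "p > 0" and u: "normal_solution (K_pow p) u"
  obtains c U where "normal_potential p c U"
    and "(\<integral>x. K_pow p x * exp (4 * u x) \<partial>lebesgue) = (\<integral>x. K_pow p x * exp (4 * U x) \<partial>lborel)"
proof -
  have K_meas[measurable]: "K_pow p \<in> borel_measurable borel"
    unfolding K_pow_def by measurable
  let ?g = "\<lambda>y. K_pow p y * exp (4 * u y)"
  have g: "integrable lebesgue ?g" using u by (simp add: normal_solution_def)
  obtain c where c: "AE x in lebesgue.
        integrable lebesgue (\<lambda>y. ln (norm y / norm (x - y)) * K_pow p y * exp (4 * u y)) \<and>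
        u x = 1 / (8 * pi\<^sup>2) *
          (\<integral>y. ln (norm y / norm (x - y)) * K_pow p y * exp (4 * u y) \<partial>lebesgue) + c"
    using u by (auto simp: normal_solution_def)
  obtain h where h[measurable]: "h \<in> borel_measurable borel" and gh: "AE y in lborel. ?g y = h y"
    using completion_ex_borel_measurable_real[of ?g lborel] g by auto
  have gh': "AE y in lebesgue. ?g y = h y" using gh by (rule AE_completion)
  have h_int: "integrable lborel h"
  proof -
    have "integrable lebesgue h"
      using gh' by (rule integrable_cong_AE_imp[OF g, rotated 1])
        (auto simp: measurable_completion elim: eventually_mono)
    then show ?thesis by (simp add: integrable_completion)
  qed
  have L_meas[measurable]: "(\<lambda>y. ln (norm y / norm (x - y)) * h y) \<in> borel_measurable borel" for x
    by measurable
  have ae: "AE x in lborel. integrable lborel (\<lambda>y. ln (norm y / norm (x - y)) * h y) \<and>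
      u x = 1 / (8 * pi\<^sup>2) * (\<integral>y. ln (norm y / norm (x - y)) * h y \<partial>lborel) + c"
  proof -
    have "AE x in lborel.
        integrable lebesgue (\<lambda>y. ln (norm y / norm (x - y)) * K_pow p y * exp (4 * u y)) \<and>
        u x = 1 / (8 * pi\<^sup>2) *
          (\<integral>y. ln (norm y / norm (x - y)) * K_pow p y * exp (4 * u y) \<partial>lebesgue) + c"
      using c by (simp add: AE_completion_iff)
    then show ?thesis
    proof eventually_elim
      case (elim x)
      have eq: "AE y in lebesgue. ln (norm y / norm (x - y)) * K_pow p y * exp (4 * u y)
          = ln (norm y / norm (x - y)) * h y"
        using gh' by eventually_elim (simp add: mult.assoc)
      have i: "integrable lebesgue (\<lambda>y. ln (norm y / norm (x - y)) * h y)"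
        by (rule integrable_cong_AE_imp[of _ "\<lambda>y. ln (norm y / norm (x - y)) * K_pow p y * exp (4 * u y)"])
          (use elim eq in \<open>auto simp: measurable_completion elim: eventually_mono\<close>)
      have "(\<integral>y. ln (norm y / norm (x - y)) * K_pow p y * exp (4 * u y) \<partial>lebesgue)
          = (\<integral>y. ln (norm y / norm (x - y)) * h y \<partial>lebesgue)"
        by (rule integral_cong_AE)
          (use elim eq in \<open>auto simp: measurable_completion\<close>)
      then show ?case
        using elim i by (simp add: integrable_completion integral_completion)
    qed
  qed
  define q where "q = (\<lambda>y::real^4. ln (norm y) - ln (1 + norm y))"
  have [measurable]: "q \<in> borel_measurable borel" unfolding q_def by measurable
  have q_int: "integrable lborel (\<lambda>y. q y * h y)"
  proof -
    \<comment> \<open>A single nonzero point \<open>x\<close> at which the original integral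
      converges is enough: near the origin |x - y| stays between positive bounds, so the original
      kernel controls log |y|; away from the origin \<open>q\<close> is bounded.\<close>
    have "AE x in lborel. integrable lborel (\<lambda>y. ln (norm y / norm (x - y)) * h y) \<and> x \<noteq> 0"
      using ae AE_lborel_neq[of 0] by eventually_elim auto
    moreover have "ae_filter (lborel :: (real^4) measure) \<noteq> bot"
      by (simp add: ae_filter_eq_bot_iff)
    ultimately obtain x where x: "integrable lborel (\<lambda>y. ln (norm y / norm (x - y)) * h y)" "x \<noteq> 0"
      using eventually_happens' by blast
    define r where "r = norm x / 2"
    have r: "r > 0" using x by (simp add: r_def)
    \<comment> \<open>The first three terms serve for |y| < r, where r <= |x - y| <= 3r; the last
      one serves for |y| >= r.\<close>
    define C where "C = \<bar>ln r\<bar> + \<bar>ln (3 * r)\<bar> + ln (1 + r) + ln (1 + 1 / r)"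
    have C_nn: "0 \<le> \<bar>ln r\<bar> + \<bar>ln (3 * r)\<bar> + ln (1 + r)" "0 \<le> ln (1 + 1 / r)" using r by auto
    have q_le: "\<bar>q y\<bar> \<le> \<bar>ln (norm y / norm (x - y))\<bar> + C" if y: "y \<noteq> 0" for y
    proof (cases "norm y < r")
      case True
      have d: "r \<le> norm (x - y)" "norm (x - y) \<le> 3 * r"
        using norm_triangle_ineq2[of x y] norm_triangle_ineq4[of x y] True by (auto simp: r_def)
      have "ln r \<le> ln (norm (x - y))" "ln (norm (x - y)) \<le> ln (3 * r)"
        using d r by (auto intro!: ln_mono)
      moreover have "ln (1 + norm y) \<le> ln (1 + r)" "0 \<le> ln (1 + norm y)"
        using True r by (auto intro!: ln_mono intro: add_pos_nonneg)
      moreover have "ln (norm y / norm (x - y)) = ln (norm y) - ln (norm (x - y))"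
        using y d r by (intro ln_divide_pos) auto
      ultimately show ?thesis
        using C_nn unfolding q_def C_def by linarith
    next
      case False
      have "ln (1 + norm y) - ln (norm y) = ln ((1 + norm y) / norm y)"
        using y by (subst ln_divide_pos) (auto intro: add_pos_nonneg)
      also have "\<dots> = ln (1 + 1 / norm y)"
        using y by (simp add: add_divide_distrib add.commute)
      also have "\<dots> \<le> ln (1 + 1 / r)"
        using False r y by (intro ln_mono add_left_mono divide_left_mono) (auto intro: add_pos_nonneg)
      finally have "ln (1 + norm y) - ln (norm y) \<le> ln (1 + 1 / r)" .
      moreover have "ln (norm y) \<le> ln (1 + norm y)" using y by (intro ln_mono) (auto intro: add_pos_nonneg)
      ultimately show ?thesis
        using C_nn unfolding q_def C_def by linarith
    qed
    show ?thesis
    proof (rule Bochner_Integration.integrable_bound)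
      show "integrable lborel (\<lambda>y. \<bar>ln (norm y / norm (x - y)) * h y\<bar> + C * \<bar>h y\<bar>)"
        by (intro Bochner_Integration.integrable_add integrable_abs x integrable_mult_right h_int)
      show "AE y in lborel. norm (q y * h y) \<le> norm (\<bar>ln (norm y / norm (x - y)) * h y\<bar> + C * \<bar>h y\<bar>)"
        using AE_lborel_neq[of 0]
      proof eventually_elim
        case (elim y)
        have "\<bar>q y\<bar> * \<bar>h y\<bar> \<le> (\<bar>ln (norm y / norm (x - y))\<bar> + C) * \<bar>h y\<bar>"
          by (intro mult_right_mono q_le elim) simp
        then show ?case
          by (simp add: abs_mult distrib_right) (meson abs_ge_self order.trans)
      qed
    qed measurable
  qed
  define c' where "c' = 1 / (8 * pi\<^sup>2) * (\<integral>y. q y * h y \<partial>lborel) + c"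
  define U where "U = (\<lambda>x. 1 / (8 * pi\<^sup>2) * (\<integral>y. logk x y * h y \<partial>lborel) + c')"
  have U_meas[measurable]: "U \<in> borel_measurable borel" unfolding U_def by measurable
  have ae_logk: "AE x in lborel. integrable lborel (\<lambda>y. logk x y * h y) \<and> u x = U x"
    using ae
  proof eventually_elim
    case (elim x)
    have eq: "AE y in lborel. ln (norm y / norm (x - y)) * h y - q y * h y = logk x y * h y"
      using AE_lborel_neq[of 0] AE_lborel_neq[of x]
    proof eventually_elim
      case (elim y)
      then show ?case
        by (simp add: ln_divide_pos logk_def q_def algebra_simps)
    qed
    have i0: "integrable lborel (\<lambda>y. ln (norm y / norm (x - y)) * h y - q y * h y)"
      using elim q_int by auto
    have i: "integrable lborel (\<lambda>y. logk x y * h y)"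
      by (rule integrable_cong_AE_imp[OF i0]) (use eq in \<open>auto elim: eventually_mono\<close>)
    have "(\<integral>y. logk x y * h y \<partial>lborel) = (\<integral>y. ln (norm y / norm (x - y)) * h y - q y * h y \<partial>lborel)"
      by (rule integral_cong_AE) (use eq in \<open>auto elim: eventually_mono\<close>)
    also have "\<dots> = (\<integral>y. ln (norm y / norm (x - y)) * h y \<partial>lborel) - (\<integral>y. q y * h y \<partial>lborel)"
      using elim q_int by (intro Bochner_Integration.integral_diff) auto
    finally show ?case
      using elim i by (simp add: U_def c'_def right_diff_distrib diff_divide_distrib)
  qed
  have fh: "AE y in lborel. K_pow p y * exp (4 * U y) = h y"
    using gh ae_logk by eventually_elim simp
  have logk_cong: "AE y in lborel. logk x y * (K_pow p y * exp (4 * U y)) = logk x y * h y" for x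
    using fh by eventually_elim simp
  have "normal_potential p c' U"
  proof
    show "integrable lborel (\<lambda>y. K_pow p y * exp (4 * U y))"
      by (rule integrable_cong_AE_imp[OF h_int]) (use fh in \<open>auto elim: eventually_mono\<close>)
    show "AE x in lborel. integrable lborel (\<lambda>y. logk x y * (K_pow p y * exp (4 * U y)))"
      using ae_logk
    proof eventually_elim
      case (elim x)
      show ?case
        by (rule integrable_cong_AE_imp[of _ "\<lambda>y. logk x y * h y"])
          (use elim logk_cong[of x] in \<open>auto elim: eventually_mono\<close>)
    qed
    show "U x = 1 / (8 * pi\<^sup>2) * (\<integral>y. logk x y * (K_pow p y * exp (4 * U y)) \<partial>lborel) + c'" for x
    proof -
      have "(\<integral>y. logk x y * (K_pow p y * exp (4 * U y)) \<partial>lborel) = (\<integral>y. logk x y * h y \<partial>lborel)"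
        by (rule integral_cong_AE) (use logk_cong[of x] in auto)
      then show ?thesis by (simp add: U_def)
    qed
  qed (use p in auto)
  moreover have "(\<integral>x. K_pow p x * exp (4 * u x) \<partial>lebesgue) = (\<integral>x. K_pow p x * exp (4 * U x) \<partial>lborel)"
  proof -
    have "(\<integral>x. K_pow p x * exp (4 * u x) \<partial>lebesgue) = (\<integral>x. h x \<partial>lebesgue)"
      by (rule integral_cong_AE) (use g gh' in \<open>auto simp: measurable_completion\<close>)
    also have "\<dots> = (\<integral>x. h x \<partial>lborel)"
      by (rule integral_completion) simp
    also have "\<dots> = (\<integral>x. K_pow p x * exp (4 * U x) \<partial>lborel)"
      by (rule integral_cong_AE) (use fh in \<open>auto elim: eventually_mono\<close>)
    finally show ?thesis .
  qed
  ultimately show thesis by (rule that)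
qed

lemma normal_solution_mass_bounds:
  assumes "p > 0" and "normal_solution (K_pow p) u"
  shows "Lambda_star p \<le> (\<integral>x. K_pow p x * exp (4 * u x) \<partial>lebesgue)"
    and "(\<integral>x. K_pow p x * exp (4 * u x) \<partial>lebesgue) < Lambda_sph"
proof -
  obtain c U where "normal_potential p c U"
    and eq: "(\<integral>x. K_pow p x * exp (4 * u x) \<partial>lebesgue) = (\<integral>x. K_pow p x * exp (4 * U x) \<partial>lborel)"
    using normal_potential_of_normal_solution[OF assms] .
  then interpret normal_potential p c U by simp
  have dens: "(\<integral>x. K_pow p x * exp (4 * U x) \<partial>lborel) = integral\<^sup>L lborel dens"
    unfolding dens_def ..
  show "Lambda_star p \<le> (\<integral>x. K_pow p x * exp (4 * u x) \<partial>lebesgue)"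
    unfolding eq dens Lambda_star_def by (rule mass_ge_star)
  show "(\<integral>x. K_pow p x * exp (4 * u x) \<partial>lebesgue) < Lambda_sph"
    unfolding eq dens Lambda_sph_def by (rule mass_less_sphere)
qed

theorem theorem1p1:
  fixes p :: real
  assumes "p > 0"
  shows "(\<forall>\<Lambda> \<in> {..<Lambda_star p} \<union> {Lambda_sph..}.
            \<not> (\<exists>u. normal_solution (K_pow p) u \<and>
                   \<Lambda> = (\<integral>x. K_pow p x * exp (4 * u x) \<partial>lebesgue))) \<and>
         (p \<ge> 4 \<longrightarrow>
           (\<forall>\<Lambda>::real. \<not> (\<exists>u. normal_solution (K_pow p) u \<and>
                   \<Lambda> = (\<integral>x. K_pow p x * exp (4 * u x) \<partial>lebesgue))))"
proof -
  \<comment> \<open>At p = 4 the two mass bounds coincide and from there on they contradict each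
    other, since the upper one is strict.\<close>
  have star: "Lambda_sph \<le> Lambda_star p" if "p \<ge> 4"
    using that by (simp add: Lambda_sph_def Lambda_star_def)
  show ?thesis
    using normal_solution_mass_bounds[OF assms] star by (fastforce simp: not_less)
qed

end
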